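(* Let $(\Omega,\Sigma)$ be a standard Borel space, let $V=BC\cap AC_4$, and let $$B=\left\{\sum_{k=1}^n\alpha_k\mu_k^{r_k}:\ n\in\mathbb{N}^+,\ \alpha_k\in\mathbb{R},\ r_k\in\mathbb{N}^+,\ \mu_k \text{ a nonatomic probability measure on }\Sigma\right\}\subset V .$$ Then the Burkill-Cesari integral $\partial^+_{\emptyset}$ is not continuous on $B$ with respect to the variation norm $\|\cdot\|$ of $BV$. Consequently $\partial^+_{\emptyset}:V\to NA$ is not continuous on $V$ equipped with the variation norm.
   Context: A standard Borel space $(\Omega,\Sigma)$ is a Borel set $\Omega$ of a Polish space together with the family $\Sigma$ of its Borel subsets. A game is a set function $\nu:\Sigma\to\mathbb{R}$ with $\nu(\emptyset)=0$. $NA$ is the space of (finite signed) nonatomic countably additive measures on $\Sigma$, regarded as a subspace of $BV$ (defined below), and $NA^+$ is the cone of its nonnegative elements. Here $\mu^r$ denotes the game $E\mapsto(\mu(E))^r$. A chain is a finite sequence $\emptyset=S_0\subset S_1\subset\dots\subset S_m=\Omega$ in $\Sigma$; a subchain $\Lambda$ is a set of links $(S_{i-1},S_i)$ of a chain, and $\|\nu\|_\Lambda$ is the sum of $|\nu(S_i)-\nu(S_{i-1})|$ over the links in $\Lambda$. $BV$ is the space of games with finite variation norm $\|\nu\|=\sup_C\|\nu\|_C$, the supremum being over all chains $C$. For $\mu\in NA^+$, $\nu\ll_4\mu$ means: for every $\varepsilon>0$ there is $\delta>0$ such that for every subchain $\Lambda$ of every chain, $\|\mu\|_\Lambda<\delta$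 implies $\|\nu\|_\Lambda<\varepsilon$. $AC_4$ is the space of games $\nu$ with $\nu\ll_4\mu$ for some $\mu\in NA^+$; one has $AC_4\subset BV$. For $E\in\Sigma$, $\Pi(E)$ is the set of finite partitions of $E$ into disjoint elements of $\Sigma$. For $\lambda\in NA^+$ and $D\in\Pi(E)$ put $\delta_\lambda(D)=\max\{\lambda(I):I\in D\}$. A game $\nu$ is $\delta_\lambda$-BC (Burkill-Cesari) integrable if for every $E\in\Sigma$ the finite limit $\partial^+_{\emptyset}(\nu,E):=\lim_{\delta_\lambda(D)\to0,\,D\in\Pi(E)}\sum_{I\in D}\nu(I)$ exists, i.e. for every $\varepsilon>0$ there is $\delta>0$ such that $|\sum_{I\in D}\nu(I)-\partial^+_{\emptyset}(\nu,E)|<\varepsilon$ for all $D\in\Pi(E)$ with $\delta_\lambda(D)<\delta$. $BC$ is the space of games that are $\delta_\lambda$-BC integrable for some $\lambda\in NA^+$; the integral (a set function of $E$) is known not to depend on the choice of such $\lambda$. The operator $\partial^+_{\emptyset}$ sends $\nu$ to the set function $E\mapsto\partial^+_{\emptyset}(\nu,E)$, which belongs to $NA$ when $\nu\in V$.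
   Formalization: The formal theorem assumes Ω uncountable; for countable Ω there is no nonatomic probability measure, so B is empty, V contains only the zero game, and both discontinuity claims fail. *)

theory Defs
  imports "HOL-Analysis.Analysis"
begin

text \<open>
  The underlying measurable space \<open>(\<Omega>, \<Sigma>)\<close> is given as \<open>M :: 'a measure\<close>, of which only
  \<open>space M = \<Omega>\<close> and \<open>sets M = \<Sigma>\<close> are used. Set functions on \<open>\<Sigma>\<close> are represented by functions on
  all of \<open>'a set\<close> that vanish outside \<open>\<Sigma>\<close> (the convention of \<^const>\<open>measure\<close>), so that equality of
  set functions on \<open>\<Sigma>\<close> is equality in HOL.
\<close>

definition game :: "'a measure \<Rightarrow> ('a set \<Rightarrow> real) \<Rightarrow> bool" where
  "game M \<nu> \<longleftrightarrow> \<nu> {} = 0 \<and> (\<forall>E. E \<notin> sets M \<longrightarrow> \<nu> E = 0)"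

definition signed_measure :: "'a measure \<Rightarrow> ('a set \<Rightarrow> real) \<Rightarrow> bool" where
  "signed_measure M \<mu> \<longleftrightarrow> game M \<mu> \<and>
     (\<forall>A :: nat \<Rightarrow> 'a set. range A \<subseteq> sets M \<longrightarrow> disjoint_family A \<longrightarrow>
        (\<lambda>i. \<mu> (A i)) sums \<mu> (\<Union>i. A i))"

text \<open>An atom of a signed measure is a set \<open>E\<close> with \<open>\<mu> E \<noteq> 0\<close> that cannot be split into two
  measurable parts that both have nonzero measure.\<close>

definition nonatomic :: "'a measure \<Rightarrow> ('a set \<Rightarrow> real) \<Rightarrow> bool" where
  "nonatomic M \<mu> \<longleftrightarrow>
     (\<forall>E\<in>sets M. \<mu> E \<noteq> 0 \<longrightarrow> (\<exists>F\<in>sets M. F \<subseteq> E \<and> \<mu> F \<noteq> 0 \<and> \<mu> (E - F) \<noteq> 0))"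

definition NA :: "'a measure \<Rightarrow> ('a set \<Rightarrow> real) set" where
  "NA M = {\<mu>. signed_measure M \<mu> \<and> nonatomic M \<mu>}"

definition NA_pos :: "'a measure \<Rightarrow> ('a set \<Rightarrow> real) set" where
  "NA_pos M = {\<mu>\<in>NA M. \<forall>E\<in>sets M. 0 \<le> \<mu> E}"

definition nonatomic_prob :: "'a measure \<Rightarrow> ('a set \<Rightarrow> real) set" where
  "nonatomic_prob M = {\<mu>\<in>NA_pos M. \<mu> (space M) = 1}"

text \<open>A chain is represented by its set of links. Inclusions need not be strict: a link \<open>(S, S)\<close>
  contributes nothing to any variation, so repetitions collapsing in the set are harmless.\<close>

definition chains :: "'a measure \<Rightarrow> ('a set \<times> 'a set) set set" where
  "chains M = {{(S i, S (Suc i)) | i. i < m} | (S :: nat \<Rightarrow> 'a set) (m :: nat).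
     S 0 = {} \<and> S m = space M \<and> (\<forall>i\<le>m. S i \<in> sets M) \<and> (\<forall>i<m. S i \<subseteq> S (Suc i))}"

definition subchains :: "'a measure \<Rightarrow> ('a set \<times> 'a set) set set" where
  "subchains M = {\<Lambda>. \<exists>C\<in>chains M. \<Lambda> \<subseteq> C}"

definition variation_on :: "('a set \<Rightarrow> real) \<Rightarrow> ('a set \<times> 'a set) set \<Rightarrow> real" where
  "variation_on \<nu> \<Lambda> = (\<Sum>(S, T)\<in>\<Lambda>. \<bar>\<nu> T - \<nu> S\<bar>)"

text \<open>The variation norm takes the value \<open>\<infinity>\<close> exactly when the variation is
  unbounded, so a game belongs to \<open>BV\<close> iff its norm is finite.\<close>

definition variation_norm :: "'a measure \<Rightarrow> ('a set \<Rightarrow> real) \<Rightarrow> ennreal" where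
  "variation_norm M \<nu> = (SUP C\<in>chains M. ennreal (variation_on \<nu> C))"

definition abs_cont4 :: "'a measure \<Rightarrow> ('a set \<Rightarrow> real) \<Rightarrow> ('a set \<Rightarrow> real) \<Rightarrow> bool" where
  "abs_cont4 M \<nu> \<mu> \<longleftrightarrow> (\<forall>\<epsilon>>0. \<exists>\<delta>>0. \<forall>\<Lambda>\<in>subchains M.
     variation_on \<mu> \<Lambda> < \<delta> \<longrightarrow> variation_on \<nu> \<Lambda> < \<epsilon>)"

definition AC4 :: "'a measure \<Rightarrow> ('a set \<Rightarrow> real) set" where
  "AC4 M = {\<nu>. game M \<nu> \<and> (\<exists>\<mu>\<in>NA_pos M. abs_cont4 M \<nu> \<mu>)}"

text \<open>The blocks of a \<^const>\<open>partition_on\<close> are nonempty; admitting the empty set as a block would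
  change neither the mesh nor the sums, because games vanish at the empty set.\<close>

definition finite_partitions :: "'a measure \<Rightarrow> 'a set \<Rightarrow> 'a set set set" where
  "finite_partitions M E = {D. finite D \<and> D \<subseteq> sets M \<and> partition_on E D}"

text \<open>The element \<open>0\<close> only matters for the partition of the empty set, which has no blocks.\<close>

definition mesh :: "('a set \<Rightarrow> real) \<Rightarrow> 'a set set \<Rightarrow> real" where
  "mesh \<kappa> D = Max (insert 0 (\<kappa> ` D))"

definition has_BC_integral_at ::
    "'a measure \<Rightarrow> ('a set \<Rightarrow> real) \<Rightarrow> ('a set \<Rightarrow> real) \<Rightarrow> 'a set \<Rightarrow> real \<Rightarrow> bool" where
  "has_BC_integral_at M \<kappa> \<nu> E l \<longleftrightarrow> (\<forall>\<epsilon>>0. \<exists>\<delta>>0. \<forall>D\<in>finite_partitions M E.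
     mesh \<kappa> D < \<delta> \<longrightarrow> \<bar>(\<Sum>I\<in>D. \<nu> I) - l\<bar> < \<epsilon>)"

definition BC_integrable :: "'a measure \<Rightarrow> ('a set \<Rightarrow> real) \<Rightarrow> ('a set \<Rightarrow> real) \<Rightarrow> bool" where
  "BC_integrable M \<kappa> \<nu> \<longleftrightarrow> (\<forall>E\<in>sets M. \<exists>l. has_BC_integral_at M \<kappa> \<nu> E l)"

definition BC :: "'a measure \<Rightarrow> ('a set \<Rightarrow> real) set" where
  "BC M = {\<nu>. game M \<nu> \<and> (\<exists>\<kappa>\<in>NA_pos M. BC_integrable M \<kappa> \<nu>)}"

text \<open>The limit does not depend on the admissible \<open>\<kappa>\<close>: for two of them, use their sum, together with
  the existence of partitions of arbitrarily small mesh.\<close>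

definition BC_integral :: "'a measure \<Rightarrow> ('a set \<Rightarrow> real) \<Rightarrow> ('a set \<Rightarrow> real)" where
  "BC_integral M \<nu> = (\<lambda>E. if E \<in> sets M
     then (THE l. \<exists>\<kappa>\<in>NA_pos M. BC_integrable M \<kappa> \<nu> \<and> has_BC_integral_at M \<kappa> \<nu> E l)
     else 0)"

definition BC_AC4 :: "'a measure \<Rightarrow> ('a set \<Rightarrow> real) set" where
  "BC_AC4 M = BC M \<inter> AC4 M"

definition power_combinations :: "'a measure \<Rightarrow> ('a set \<Rightarrow> real) set" where
  "power_combinations M = {(\<lambda>E. \<Sum>k=1..n. \<alpha> k * \<mu> k E ^ r k) |
     (n :: nat) (\<alpha> :: nat \<Rightarrow> real) (r :: nat \<Rightarrow> nat) (\<mu> :: nat \<Rightarrow> 'a set \<Rightarrow> real).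
     1 \<le> n \<and> (\<forall>k\<in>{1..n}. 1 \<le> r k \<and> \<mu> k \<in> nonatomic_prob M)}"

text \<open>Continuity on \<open>X\<close> when domain and codomain both carry the variation norm.\<close>

definition variation_continuous_on ::
    "'a measure \<Rightarrow> ('a set \<Rightarrow> real) set \<Rightarrow> (('a set \<Rightarrow> real) \<Rightarrow> ('a set \<Rightarrow> real)) \<Rightarrow> bool" where
  "variation_continuous_on M X T \<longleftrightarrow>
     (\<forall>\<nu>\<in>X. \<forall>\<epsilon>>0::real. \<exists>\<delta>>0::real. \<forall>\<nu>'\<in>X.
        variation_norm M (\<lambda>E. \<nu>' E - \<nu> E) < ennreal \<delta> \<longrightarrow>
        variation_norm M (\<lambda>E. T \<nu>' E - T \<nu> E) < ennreal \<epsilon>)"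

end

theory Submission
  imports Defs
begin

text \<open>
  For a nonatomic probability \<open>\<mu>\<close> the games \<open>\<nu>\<^sub>n = (1 - (1 - \<mu>)\<^sup>n) / n\<close> lie in the span of the powers of
  \<open>\<mu>\<close> and are monotone, so their variation norm is \<open>1 / n\<close>. The Burkill-Cesari integral sees only the
  linear term, hence sends every \<open>\<nu>\<^sub>n\<close> to \<open>\<mu>\<close>, which has norm 1: it is discontinuous at 0.

  That such a \<open>\<mu>\<close> exists rests on the perfect set property. An uncountable Borel set is the projection
  of a closed set in a Polish space, and splitting that closed set along the dyadic intervals
  gives a Borel injection of \<open>[0, 1)\<close> into the Borel set, along which Lebesgue measure is transported.

  For the range of the integral: when \<open>E\<close> is small, it is admissible as a block of a fine partition of
  the whole space, so the integral over \<open>E\<close> is close to \<open>\<nu> E\<close>, and \<open>\<nu> E\<close> is small by absolute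
  continuity. A finitely additive set function that is absolutely continuous with respect to a
  nonatomic measure is a nonatomic signed measure.
\<close>

section \<open>Borel injections of the unit interval into uncountable Borel sets\<close>

text \<open>Projections of closed sets are used instead of continuous images of the Baire space: the
  splitting below takes place in the closed set, where completeness yields limit points.
  \<open>nat \<Rightarrow> real\<close> serves as code space because it is a Polish type.\<close>

definition analytic :: "'a::polish_space set \<Rightarrow> bool" where
  "analytic A \<longleftrightarrow> (\<exists>C :: ('a \<times> (nat \<Rightarrow> real)) set. closed C \<and> A = fst ` C)"

lemma analytic_closed: "closed A \<Longrightarrow> analytic A"
  unfolding analytic_def
  by (rule exI[of _ "A \<times> UNIV"]) (auto simp: closed_Times image_iff)

lemma continuous_on_snd_coordinate:
  "continuous_on UNIV (\<lambda>p :: 'a::topological_space \<times> ('i \<Rightarrow> 'b::topological_space). snd p i)"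
  by (rule continuous_on_product_then_coordinatewise[OF continuous_on_snd[OF continuous_on_id]])

text \<open>Covers both manipulations of codes below: dropping the leading coordinate for unions,
  and extracting a row of a doubly indexed code for intersections.\<close>

lemma continuous_on_reindex_snd:
  "continuous_on UNIV (\<lambda>p :: 'a::topological_space \<times> ('i \<Rightarrow> 'b::topological_space). (fst p, \<lambda>i. snd p (f i)))"
  by (intro continuous_on_Pair continuous_on_fst continuous_on_id
      continuous_on_coordinatewise_then_product continuous_on_snd_coordinate)

lemma analytic_UN:
  fixes A :: "nat \<Rightarrow> 'a::polish_space set"
  assumes "\<And>n. analytic (A n)"
  shows "analytic (\<Union>n. A n)"
proof -
  obtain C :: "nat \<Rightarrow> ('a \<times> (nat \<Rightarrow> real)) set" where C: "\<And>n. closed (C n)" "\<And>n. A n = fst ` C n"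
    using assms unfolding analytic_def by metis
  define tl where "tl = (\<lambda>p :: 'a \<times> (nat \<Rightarrow> real). (fst p, \<lambda>i. snd p (Suc i)))"
  have tl: "continuous_on UNIV tl"
    unfolding tl_def by (rule continuous_on_reindex_snd)
  \<comment> \<open>The leading coordinate selects the \<open>n\<close>; a non-integer one imposes the conditions of both
    neighbouring integers, which keeps the set closed.\<close>
  define D where "D = (\<Inter>n. {p. 1 \<le> \<bar>snd p 0 - real n\<bar>} \<union> tl -` C n) \<inter> {p. 0 \<le> snd p 0}"
  have "closed D"
    unfolding D_def
    by (intro closed_Int closed_INT ballI closed_Un closed_vimage C tl closed_Collect_le
        continuous_on_snd_coordinate continuous_on_const
        continuous_on_rabs continuous_on_diff)
  moreover have "(\<Union>n. A n) = fst ` D"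
  proof (intro equalityI subsetI)
    fix x assume "x \<in> (\<Union>n. A n)"
    then obtain n z where n: "(x, z) \<in> C n" using C(2) by auto
    \<comment> \<open>The code of \<open>x\<close> in \<open>C n\<close> is prefixed with
      \<open>n\<close>; every other index is at distance at least 1 from it, so the first
      alternative holds there.\<close>
    have "(x, case_nat (real n) z) \<in> D"
    proof -
      have "1 \<le> \<bar>real n - real m\<bar>" if "m \<noteq> n" for m
        using that by linarith
      then show ?thesis using n unfolding D_def tl_def by force
    qed
    then show "x \<in> fst ` D" by force
  next
    fix x assume "x \<in> fst ` D"
    then obtain z where z: "(x, z) \<in> D" by auto
    \<comment> \<open>Nonnegativity of the leading coordinate makes its floor a natural number. It
      lies at distance less than 1, which rules out the first alternative for this
      \<open>n\<close>.\<close>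
    define n where "n = nat \<lfloor>z 0\<rfloor>"
    have "0 \<le> z 0" using z by (simp add: D_def)
    then have "\<bar>z 0 - real n\<bar> < 1" unfolding n_def by simp linarith
    then have "tl (x, z) \<in> C n" using z by (force simp: D_def)
    then have "x \<in> A n" unfolding C(2) by (force simp: tl_def)
    then show "x \<in> (\<Union>n. A n)" by blast
  qed
  ultimately show ?thesis unfolding analytic_def by blast
qed

text \<open>Membership in all \<open>A n\<close> requires a code for each \<open>n\<close>;
  \<open>prod_encode\<close> packs this sequence of codes into a single one, whose rows are
  constrained separately.\<close>

lemma analytic_INT:
  fixes A :: "nat \<Rightarrow> 'a::polish_space set"
  assumes "\<And>n. analytic (A n)"
  shows "analytic (\<Inter>n. A n)"
proof -
  obtain C :: "nat \<Rightarrow> ('a \<times> (nat \<Rightarrow> real)) set" where C: "\<And>n. closed (C n)" "\<And>n. A n = fst ` C n"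
    using assms unfolding analytic_def by metis
  define pr where "pr n = (\<lambda>p :: 'a \<times> (nat \<Rightarrow> real). (fst p, \<lambda>i. snd p (prod_encode (n, i))))" for n
  have pr: "continuous_on UNIV (pr n)" for n
    unfolding pr_def by (rule continuous_on_reindex_snd)
  have "closed (\<Inter>n. pr n -` C n)"
    by (intro closed_INT ballI closed_vimage C pr)
  moreover have "(\<Inter>n. A n) = fst ` (\<Inter>n. pr n -` C n)"
  proof (intro equalityI subsetI)
    fix x assume "x \<in> (\<Inter>n. A n)"
    then have "\<forall>n. \<exists>z. (x, z) \<in> C n" using C(2) by force
    then obtain z where z: "\<And>n. (x, z n) \<in> C n" by metis
    have "pr n (x, \<lambda>k. case_prod z (prod_decode k)) = (x, z n)" for n
      by (simp add: pr_def)
    then have "(x, \<lambda>k. case_prod z (prod_decode k)) \<in> (\<Inter>n. pr n -` C n)"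
      using z by auto
    then show "x \<in> fst ` (\<Inter>n. pr n -` C n)" by force
  next
    fix x assume "x \<in> fst ` (\<Inter>n. pr n -` C n)"
    then obtain z where "\<And>n. pr n (x, z) \<in> C n" by force
    then have "x \<in> A n" for n unfolding C(2) by (force simp: pr_def)
    then show "x \<in> (\<Inter>n. A n)" by blast
  qed
  ultimately show ?thesis unfolding analytic_def by blast
qed

text \<open>Analytic sets need not be closed under complements, so the induction over the generated
  sigma-algebra treats a set and its complement together. Open sets enter as countable unions of
  closed sets.\<close>

lemma analytic_borel:
  fixes A :: "'a::polish_space set"
  assumes "A \<in> sets borel"
  shows "analytic A"
proof -
  have "A \<in> sigma_sets UNIV {S. open S}" using assms by (simp add: borel_def)
  then have "analytic A \<and> analytic (- A)"
  proof induction
    case (Basic S)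
    then have "open S" by simp
    then have "fsigma_in euclidean S" "closed (- S)"
      using open_imp_fsigma_in[OF metrizable_space_euclidean, of S] by auto
    then obtain F where F: "\<And>n::nat. closed (F n)" "S = (\<Union>n. F n)"
      unfolding fsigma_in_ascending by auto
    then show ?case using \<open>closed (- S)\<close> analytic_closed analytic_UN by metis
  next
    case Empty
    show ?case by (auto intro: analytic_closed)
  next
    case (Compl a)
    then show ?case unfolding Compl_eq_Diff_UNIV[symmetric] double_complement by blast
  next
    case (Union a)
    then show ?case using analytic_UN[of a] analytic_INT[of "\<lambda>n. - a n"] by simp
  qed
  then show ?thesis ..
qed

section \<open>Cantor schemes with disjoint projections\<close>

text \<open>A Cantor-Bendixson argument for projections: discarding the points that have a
  neighbourhood with countable projection loses only countably many projected points. Small closed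
  balls around two remaining points with different projections cut out the two pieces.\<close>

lemma uncountable_image_split:
  fixes K :: "('a::polish_space \<times> 'b::polish_space) set"
  assumes K: "closed K" "uncountable (fst ` K)" and "e > 0"
  shows "\<exists>K0 K1. (closed K0 \<and> uncountable (fst ` K0)) \<and> (closed K1 \<and> uncountable (fst ` K1)) \<and>
    K0 \<subseteq> K \<and> K1 \<subseteq> K \<and> fst ` K0 \<inter> fst ` K1 = {} \<and>
    (\<forall>x\<in>K0. \<forall>y\<in>K0. dist x y < e) \<and> (\<forall>x\<in>K1. \<forall>y\<in>K1. dist x y < e)"
proof -
  \<comment> \<open>condensation points with respect to the projection\<close>
  define P where "P = {y\<in>K. \<forall>U. open U \<longrightarrow> y \<in> U \<longrightarrow> uncountable (fst ` (K \<inter> U))}"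
  obtain \<B> :: "('a \<times> 'b) set set" where \<B>: "countable \<B>" "topological_basis \<B>"
    using ex_countable_basis by blast
  \<comment> \<open>By second countability the discarded points are covered by countably many basic
    open sets, each meeting \<open>K\<close> in a set with countable projection.\<close>
  have "fst ` (K - P) \<subseteq> (\<Union>U\<in>{U\<in>\<B>. countable (fst ` (K \<inter> U))}. fst ` (K \<inter> U))"
  proof
    fix x assume "x \<in> fst ` (K - P)"
    then obtain y where y: "y \<in> K" "y \<notin> P" "x = fst y" by auto
    then obtain U where U: "open U" "y \<in> U" "countable (fst ` (K \<inter> U))" by (auto simp: P_def)
    then obtain V where V: "V \<in> \<B>" "y \<in> V" "V \<subseteq> U" using topological_basisE[OF \<B>(2)] by blast
    then have "countable (fst ` (K \<inter> V))" 
      by (intro countable_subset[OF _ U(3)]) auto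
    then show "x \<in> (\<Union>U\<in>{U\<in>\<B>. countable (fst ` (K \<inter> U))}. fst ` (K \<inter> U))"
      using V y by auto
  qed
  moreover have "countable (\<Union>U\<in>{U\<in>\<B>. countable (fst ` (K \<inter> U))}. fst ` (K \<inter> U))"
    using \<B>(1) by (intro countable_UN) auto
  ultimately have "countable (fst ` (K - P))" by (rule countable_subset)
  moreover have "fst ` K \<subseteq> fst ` P \<union> fst ` (K - P)" by auto
  ultimately have unc: "uncountable (fst ` P)"
    using K(2) countable_Un countable_subset by metis
  then obtain a where a: "a \<in> P" by fastforce
  have "\<not> fst ` P \<subseteq> {fst a}" using unc by (metis countable_empty countable_insert countable_subset)
  then obtain b where b: "b \<in> P" "fst a \<noteq> fst b" by force
  \<comment> \<open>The first bound keeps the diameters below \<open>e\<close>; the second keeps the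
    projected balls disjoint, since \<open>fst\<close> does not increase distances.\<close>
  define r where "r = min (e / 4) (dist (fst a) (fst b) / 4)"
  have r: "r > 0" "4 * r \<le> e" "4 * r \<le> dist (fst a) (fst b)" using b \<open>e > 0\<close> by (auto simp: r_def)
  have ball: "uncountable (fst ` (K \<inter> cball y r))" if "y \<in> P" for y
  proof -
    have "uncountable (fst ` (K \<inter> ball y r))" using that r(1) by (simp add: P_def)
    moreover have "fst ` (K \<inter> ball y r) \<subseteq> fst ` (K \<inter> cball y r)" by force
    ultimately show ?thesis using countable_subset by blast
  qed
  have small: "dist x y < e" if "x \<in> K \<inter> cball c r" "y \<in> K \<inter> cball c r" for x y c
    using that r dist_triangle3[of x y c] unfolding Int_iff mem_cball by linarith
  have disj: "fst ` (K \<inter> cball a r) \<inter> fst ` (K \<inter> cball b r) = {}"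
  proof (rule ccontr)
    assume "\<not> ?thesis"
    then obtain z where z: "z \<in> fst ` (K \<inter> cball a r)" "z \<in> fst ` (K \<inter> cball b r)" by blast
    obtain x where x: "x \<in> cball a r" "z = fst x" using z(1) by blast
    obtain y where y: "y \<in> cball b r" "z = fst y" using z(2) by blast
    have xy: "x \<in> cball a r" "y \<in> cball b r" "fst x = fst y" using x y by auto
    have "dist (fst a) (fst x) \<le> r"
      using dist_fst_le[of a x] xy(1) unfolding mem_cball by linarith
    moreover have "dist (fst b) (fst x) \<le> r"
      using dist_fst_le[of b y] xy(2) unfolding mem_cball xy(3) by linarith
    ultimately show False using dist_triangle2[of "fst a" "fst b" "fst x"] r by linarith
  qed
  show ?thesis
  proof (intro exI conjI)
    show "closed (K \<inter> cball a r)" "closed (K \<inter> cball b r)" using K(1) by auto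
    show "uncountable (fst ` (K \<inter> cball a r))" "uncountable (fst ` (K \<inter> cball b r))"
      using ball a b by blast+
    show "\<forall>x\<in>K \<inter> cball a r. \<forall>y\<in>K \<inter> cball a r. dist x y < e"
      "\<forall>x\<in>K \<inter> cball b r. \<forall>y\<in>K \<inter> cball b r. dist x y < e"
      using small by blast+
    show "fst ` (K \<inter> cball a r) \<inter> fst ` (K \<inter> cball b r) = {}" by (rule disj)
  qed (rule Int_lower1)+
qed

text \<open>Halving the index of a dyadic interval gives the index of its parent, which is how
  \<open>cantor_scheme\<close> recurses.\<close>

lemma floor_power2_Suc_div: "\<lfloor>2 ^ Suc n * x\<rfloor> div 2 = \<lfloor>2 ^ n * (x::real)\<rfloor>"
proof -
  have "\<lfloor>(2 ^ Suc n * x) / real_of_int 2\<rfloor> = \<lfloor>2 ^ Suc n * x\<rfloor> div 2"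
    by (rule floor_divide_real_eq_div) simp
  then show ?thesis by simp
qed

lemma floor_power2_separates:
  fixes x y :: real
  assumes "x \<noteq> y"
  shows "\<exists>n. \<lfloor>2 ^ n * x\<rfloor> \<noteq> \<lfloor>2 ^ n * y\<rfloor>"
proof -
  obtain n where n: "1 / \<bar>x - y\<bar> < 2 ^ n" using real_arch_pow[of 2 "1 / \<bar>x - y\<bar>"] by auto
  then have "1 < 2 ^ n * \<bar>x - y\<bar>"
    using assms by (simp add: field_simps)
  also have "\<dots> = \<bar>2 ^ n * x - 2 ^ n * y\<bar>"
    by (simp add: abs_mult flip: right_diff_distrib)
  finally have "1 < \<bar>2 ^ n * x - 2 ^ n * y\<bar>" .
  then have "\<lfloor>2 ^ n * x\<rfloor> \<noteq> \<lfloor>2 ^ n * y\<rfloor>" by linarith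
  then show ?thesis ..
qed

text \<open>The set indexed by \<open>(n, k)\<close> is to contain the image of the dyadic interval
  \<open>[k / 2^n, (k + 1) / 2^n)\<close>.\<close>

primrec cantor_scheme :: "(nat \<Rightarrow> 'b set \<Rightarrow> 'b set \<times> 'b set) \<Rightarrow> 'b set \<Rightarrow> nat \<Rightarrow> int \<Rightarrow> 'b set" where
  "cantor_scheme sp C 0 k = C"
| "cantor_scheme sp C (Suc n) k =
    (if even k then fst else snd) (sp n (cantor_scheme sp C n (k div 2)))"

text \<open>The dyadic intervals around \<open>x\<close> select a branch of the scheme; the point on
  that branch, projected, is \<open>h x\<close>. Disjoint projections give injectivity, and
  shrinking diameters exhibit \<open>h\<close> as a limit of step functions.\<close>

theorem uncountable_borel_injection:
  fixes A :: "'a::polish_space set"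
  assumes "A \<in> sets borel" "uncountable A"
  shows "\<exists>h :: real \<Rightarrow> 'a. h \<in> borel_measurable borel \<and> inj_on h {0..<1} \<and> h ` {0..<1} \<subseteq> A"
proof -
  obtain C :: "('a \<times> (nat \<Rightarrow> real)) set" where C: "closed C" "A = fst ` C"
    using analytic_borel[OF assms(1)] unfolding analytic_def by blast
  define big where "big K \<longleftrightarrow> closed K \<and> uncountable (fst ` K)" for K :: "('a \<times> (nat \<Rightarrow> real)) set"
  define splits where "splits n K p \<longleftrightarrow> big (fst p) \<and> big (snd p) \<and> fst p \<subseteq> K \<and> snd p \<subseteq> K \<and>
      fst ` fst p \<inter> fst ` snd p = {} \<and>
      (\<forall>x\<in>fst p. \<forall>y\<in>fst p. dist x y < inverse (Suc n)) \<and>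
      (\<forall>x\<in>snd p. \<forall>y\<in>snd p. dist x y < inverse (Suc n))"
    for n :: nat and K :: "('a \<times> (nat \<Rightarrow> real)) set" and p
  \<comment> \<open>The choice is total in level and set, so that the scheme can be defined by
    recursion. It is a genuine split for \<open>big\<close> sets, and its pieces are
    \<open>big\<close> again.\<close>
  define sp where "sp n K = (SOME p. splits n K p)" for n K
  have sp: "splits n K (sp n K)" if "big K" for n K
    unfolding sp_def
  proof (rule someI_ex)
    show "\<exists>p. splits n K p"
    proof -
      have "closed K" "uncountable (fst ` K)" "0 < inverse (real (Suc n))"
        using that by (simp_all add: big_def)
      from uncountable_image_split[OF this] show ?thesis
        unfolding splits_def big_def split_paired_Ex fst_conv snd_conv .
    qed
  qed
  define K where "K = cantor_scheme sp C"
  have K0: "K 0 k = C" and KS: "K (Suc n) k = (if even k then fst else snd) (sp n (K n (k div 2)))" for n k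
    by (simp_all add: K_def)
  have big: "big (K n k)" for n k
  proof (induction n arbitrary: k)
    case 0
    show ?case using C assms(2) by (simp add: K0 big_def)
  next
    case (Suc n)
    show ?case using sp[OF Suc.IH[of "k div 2"], of n] by (simp add: KS splits_def)
  qed
  have sub: "K (Suc n) k \<subseteq> K n (k div 2)" for n k
    using sp[OF big] by (simp add: KS splits_def)
  have small: "dist x y < inverse (Suc n)" if "x \<in> K (Suc n) k" "y \<in> K (Suc n) k" for n k x y
    using sp[OF big] that by (simp add: KS splits_def split: if_splits)
  \<comment> \<open>Different indices either share a parent, so that the pieces come from one split,
    or have different parents with disjoint projections. The bound on the indices matters at level
    0, where every index gives \<open>C\<close>.\<close>
  have disj: "fst ` K n k \<inter> fst ` K n l = {}" if "k \<in> {0..<2^n}" "l \<in> {0..<2^n}" "k \<noteq> l" for n k l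
    using that
  proof (induction n arbitrary: k l)
    case (Suc n)
    show ?case
    proof (cases "k div 2 = l div 2")
      case True
      with Suc.prems have "even k \<noteq> even l" by presburger
      then show ?thesis using sp[OF big[of n "l div 2"], of n] True by (auto simp: KS splits_def)
    next
      case False
      have "fst ` K n (k div 2) \<inter> fst ` K n (l div 2) = {}"
        using Suc.prems False by (intro Suc.IH) auto
      then show ?thesis using sub[of n k] sub[of n l] by blast
    qed
  qed auto
  define t where "t n x = \<lfloor>2 ^ n * x\<rfloor>" for n :: nat and x :: real
  have tS: "t (Suc n) x div 2 = t n x" for n x
    unfolding t_def by (rule floor_power2_Suc_div)
  have t_range: "t n x \<in> {0..<2^n}" if "x \<in> {0..<1}" for n x
    using that by (simp add: t_def floor_less_iff)
  \<comment> \<open>Nested nonempty closed sets with diameters tending to 0 meet in a point. This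
    holds for every real \<open>x\<close>, which makes \<open>g\<close> total.\<close>
  have "\<exists>y. \<forall>n. y \<in> K n (t n x)" for x
  proof -
    have mono: "K n (t n x) \<subseteq> K m (t m x)" if "m \<le> n" for m n
      using that sub tS lift_Suc_antimono_le[of "\<lambda>n. K n (t n x)"] by metis
    have "\<exists>y. \<Inter>(range (\<lambda>n. K n (t n x))) = {y}"
    proof (rule decreasing_closed_nest_sing)
      fix n show "closed (K n (t n x))" "K n (t n x) \<noteq> {}"
        using big[of n "t n x"] by (auto simp: big_def)
    next
      fix e :: real assume "e > 0"
      then obtain n where "inverse (real (Suc n)) < e" using reals_Archimedean by blast
      then have "\<forall>u\<in>K (Suc n) (t (Suc n) x). \<forall>v\<in>K (Suc n) (t (Suc n) x). dist u v < e"
        using small by (meson less_trans)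
      then show "\<exists>n. \<forall>u\<in>K n (t n x). \<forall>v\<in>K n (t n x). dist u v < e" by blast
    qed (use mono in auto)
    then show ?thesis by blast
  qed
  then obtain g where g: "\<And>x n. g x \<in> K n (t n x)" by metis
  \<comment> \<open>One point is fixed for each index, so that \<open>fst (c n (t n x))\<close>
    depends on \<open>x\<close> only through an integer and is therefore measurable in
    \<open>x\<close>.\<close>
  define c where "c n k = (SOME z. z \<in> K n k)" for n k
  have c: "c n k \<in> K n k" for n k
  proof -
    have "K n k \<noteq> {}" using big[of n k] by (auto simp: big_def)
    then show ?thesis unfolding c_def by (rule some_in_eq[THEN iffD2])
  qed
  have "(\<lambda>x. fst (g x)) \<in> borel_measurable borel"
  proof (rule borel_measurable_LIMSEQ_metric)
    show "(\<lambda>x. fst (c n (t n x))) \<in> borel_measurable borel" for n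
      unfolding t_def
      by (rule measurable_compose[where N = "count_space UNIV" and g = "\<lambda>k. fst (c n k)"]) measurable
  next
    fix x :: real assume "x \<in> space borel"
    \<comment> \<open>The diameter bound starts at level 1, hence the shifted sequence.\<close>
    have "(\<lambda>n. fst (c (Suc n) (t (Suc n) x))) \<longlonglongrightarrow> fst (g x)"
    proof (rule metric_LIMSEQ_I)
      fix e :: real assume "e > 0"
      then obtain N where N: "inverse (real (Suc N)) < e" using reals_Archimedean by blast
      have "dist (fst (c (Suc n) (t (Suc n) x))) (fst (g x)) < e" if "n \<ge> N" for n
      proof -
        have "dist (fst (c (Suc n) (t (Suc n) x))) (fst (g x)) \<le> dist (c (Suc n) (t (Suc n) x)) (g x)"
          by (rule dist_fst_le)
        also have "\<dots> < inverse (Suc n)" using c g by (rule small)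
        also have "\<dots> \<le> inverse (Suc N)" using that by (simp add: le_imp_inverse_le)
        finally show ?thesis using N by simp
      qed
      then show "\<exists>N. \<forall>n\<ge>N. dist (fst (c (Suc n) (t (Suc n) x))) (fst (g x)) < e" by blast
    qed
    then show "(\<lambda>n. fst (c n (t n x))) \<longlonglongrightarrow> fst (g x)" by (simp add: filterlim_sequentially_Suc[of "\<lambda>n. fst (c n (t n x))"])
  qed
  moreover have "inj_on (\<lambda>x. fst (g x)) {0..<1}"
  proof (rule inj_onI, rule ccontr)
    fix x y :: real assume xy: "x \<in> {0..<1}" "y \<in> {0..<1}" "fst (g x) = fst (g y)" "x \<noteq> y"
    then obtain n where n: "t n x \<noteq> t n y" using floor_power2_separates unfolding t_def by blast
    have "fst ` K n (t n x) \<inter> fst ` K n (t n y) = {}"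
      using xy n t_range by (intro disj) auto
    then show False using g[of x n] g[of y n] xy(3) by force
  qed
  moreover have "fst (g x) \<in> A" for x
    using g[of x 0] by (simp add: C(2) K0)
  ultimately show ?thesis by (intro exI[of _ "\<lambda>x. fst (g x)"]) auto
qed

section \<open>Nonatomic measures and fine partitions\<close>

lemma signed_measure_empty: "signed_measure M \<mu> \<Longrightarrow> \<mu> {} = 0"
  by (simp add: signed_measure_def game_def)

lemma additive_signed_measure:
  assumes "signed_measure M \<mu>"
  shows "additive (sets M) \<mu>"
  unfolding additive_def
proof (intro ballI impI)
  fix A B assume AB: "A \<in> sets M" "B \<in> sets M" "A \<inter> B = {}"
  have "range (binaryset A B) \<subseteq> sets M" "disjoint_family (binaryset A B)"
    using AB by (auto simp: range_binaryset_eq disjoint_family_on_def binaryset_def)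
  then have "(\<lambda>i. \<mu> (binaryset A B i)) sums \<mu> (\<Union>i. binaryset A B i)"
    using assms unfolding signed_measure_def by blast
  moreover have "(\<lambda>i. \<mu> (binaryset A B i)) sums (\<mu> A + \<mu> B)"
    using signed_measure_empty[OF assms] by (rule binaryset_sums)
  ultimately show "\<mu> (A \<union> B) = \<mu> A + \<mu> B"
    by (simp add: UN_binaryset_eq sums_unique2)
qed

lemma additiveD: "additive \<A> \<mu> \<Longrightarrow> A \<in> \<A> \<Longrightarrow> B \<in> \<A> \<Longrightarrow> A \<inter> B = {} \<Longrightarrow> \<mu> (A \<union> B) = \<mu> A + \<mu> B"
  by (simp add: additive_def)

lemma additive_Diff:
  fixes \<mu> :: "'a set \<Rightarrow> real"
  assumes "additive (sets M) \<mu>" "A \<in> sets M" "B \<in> sets M" "B \<subseteq> A"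
  shows "\<mu> (A - B) = \<mu> A - \<mu> B"
  using additiveD[OF assms(1), of B "A - B"] assms by (simp add: Un_absorb1)

lemma additive_sum_disjoint:
  fixes \<mu> :: "'a set \<Rightarrow> real"
  assumes "additive (sets M) \<mu>" "\<mu> {} = 0" "finite J" "\<And>i. i \<in> J \<Longrightarrow> A i \<in> sets M" "disjoint_family_on A J"
  shows "(\<Sum>i\<in>J. \<mu> (A i)) = \<mu> (\<Union>i\<in>J. A i)"
  using assms(3-)
proof induction
  case (insert i J)
  have "\<mu> (A i \<union> (\<Union>i\<in>J. A i)) = \<mu> (A i) + \<mu> (\<Union>i\<in>J. A i)"
    using insert.prems insert.hyps
    by (intro additiveD[OF assms(1)]) (auto simp: disjoint_family_on_def)
  moreover have "disjoint_family_on A J"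
    using insert.prems(2) by (auto simp: disjoint_family_on_def)
  ultimately show ?case using insert by simp
qed (simp add: assms(2))

lemma finite_partitionsD:
  assumes "D \<in> finite_partitions M E"
  shows "finite D" "D \<subseteq> sets M" "\<Union>D = E" "disjoint D" "{} \<notin> D"
  using assms by (auto simp: finite_partitions_def partition_on_def)

lemma finite_partitionsI:
  "finite D \<Longrightarrow> D \<subseteq> sets M \<Longrightarrow> \<Union>D = E \<Longrightarrow> disjoint D \<Longrightarrow> {} \<notin> D \<Longrightarrow> D \<in> finite_partitions M E"
  by (auto simp: finite_partitions_def partition_on_def)

lemma additive_sum_partition:
  fixes \<mu> :: "'a set \<Rightarrow> real"
  assumes "additive (sets M) \<mu>" "\<mu> {} = 0" "D \<in> finite_partitions M E"
  shows "(\<Sum>I\<in>D. \<mu> I) = \<mu> E"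
  using additive_sum_disjoint[OF assms(1,2), of D "\<lambda>I. I"] finite_partitionsD[OF assms(3)]
  by (auto simp: disjoint_family_on_def disjoint_def)

text \<open>In a partition of \<open>E\<close> into blocks smaller than
  \<open>\<bar>\<mu> E\<bar>\<close>, some block has nonzero measure by additivity. Since it cannot
  carry the whole of \<open>\<mu> E\<close>, its complement in \<open>E\<close> has nonzero measure
  too.\<close>

lemma nonatomic_if_arbitrarily_fine:
  assumes add: "additive (sets M) \<mu>" "\<mu> {} = 0"
    and fine: "\<And>E \<epsilon>. E \<in> sets M \<Longrightarrow> \<epsilon> > 0 \<Longrightarrow> \<exists>D\<in>finite_partitions M E. \<forall>I\<in>D. \<bar>\<mu> I\<bar> < \<epsilon>"
  shows "nonatomic M \<mu>"
  unfolding nonatomic_def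
proof (intro ballI impI)
  fix E assume E: "E \<in> sets M" "\<mu> E \<noteq> 0"
  then obtain D where D: "D \<in> finite_partitions M E" "\<forall>I\<in>D. \<bar>\<mu> I\<bar> < \<bar>\<mu> E\<bar>"
    using fine[of E "\<bar>\<mu> E\<bar>"] by auto
  have "(\<Sum>I\<in>D. \<mu> I) \<noteq> 0" using E additive_sum_partition[OF add D(1)] by simp
  then obtain I where I: "I \<in> D" "\<mu> I \<noteq> 0" by (meson sum.neutral)
  have I': "I \<in> sets M" "I \<subseteq> E" using finite_partitionsD[OF D(1)] I(1) by auto
  have "\<mu> (E - I) \<noteq> 0"
    using additive_Diff[OF add(1) E(1) I'] D(2) I(1) by auto
  with I I' show "\<exists>F\<in>sets M. F \<subseteq> E \<and> \<mu> F \<noteq> 0 \<and> \<mu> (E - F) \<noteq> 0" by blast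
qed

lemma signed_measure_measure:
  assumes "finite_measure N" "sets N = sets M"
  shows "signed_measure M (measure N)"
  using finite_measure.finite_measure_UNION[OF assms(1)] assms(2)
  by (auto simp: signed_measure_def game_def measure_notin_sets)

text \<open>Gives access to continuity and monotonicity of finite measures. The equality holds for
  all sets because both sides vanish outside the sigma-algebra.\<close>

lemma nonneg_signed_measure_imp_measure:
  assumes "signed_measure M \<mu>" "\<And>E. E \<in> sets M \<Longrightarrow> 0 \<le> \<mu> E"
  obtains N where "finite_measure N" "sets N = sets M" "\<mu> = measure N"
proof -
  define N where "N = measure_of (space M) (sets M) (\<lambda>E. ennreal (\<mu> E))"
  have sets: "sets N = sets M" by (simp add: N_def)
  have ca: "countably_additive (sets N) (\<lambda>E. ennreal (\<mu> E))"
    unfolding countably_additive_def sets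
  proof (intro allI impI)
    fix A :: "nat \<Rightarrow> _" assume A: "range A \<subseteq> sets M" "disjoint_family A"
    then have "(\<lambda>i. \<mu> (A i)) sums \<mu> (\<Union>i. A i)"
      using assms(1) unfolding signed_measure_def by blast
    then show "(\<Sum>i. ennreal (\<mu> (A i))) = ennreal (\<mu> (\<Union>i. A i))"
      using A assms(2) by (intro suminf_ennreal_eq) auto
  qed
  have em: "emeasure N E = ennreal (\<mu> E)" if "E \<in> sets M" for E
    by (rule emeasure_measure_of[OF N_def sets.space_closed _ ca])
      (use that sets in \<open>auto simp: positive_def signed_measure_empty[OF assms(1)]\<close>)
  have "\<mu> = measure N"
  proof
    fix E show "\<mu> E = measure N E"
    proof (cases "E \<in> sets M")
      case True
      then show ?thesis by (simp add: measure_def em assms(2))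
    next
      case False
      then show ?thesis using assms(1) sets by (simp add: signed_measure_def game_def measure_notin_sets)
    qed
  qed
  moreover have "finite_measure N"
    by (rule finite_measureI) (use em[of "space N"] sets sets.top[of N] in simp)
  ultimately show ?thesis using that sets by blast
qed

section \<open>Fine partitions in standard Borel spaces\<close>

locale borel_subspace =
  fixes \<Omega> :: "'a::polish_space set" and M :: "'a measure"
  assumes borel_\<Omega>: "\<Omega> \<in> sets borel"
    and M_eq: "M = restrict_space borel \<Omega>"
begin

lemma space_M: "space M = \<Omega>"
  by (simp add: M_eq space_restrict_space)

lemma sets_M_iff: "A \<in> sets M \<longleftrightarrow> A \<subseteq> \<Omega> \<and> A \<in> sets borel"
  using borel_\<Omega> by (simp add: M_eq sets_restrict_space_iff)

text \<open>Balls around a point shrink to that point, so one of them has measure below \<delta>.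
  Lindelof's theorem makes this cover countable; finitely many of its disjointed pieces, together
  with a remainder, form the partition.\<close>

lemma diffuse_imp_arbitrarily_fine:
  assumes N: "finite_measure N" "sets N = sets M" "\<And>x. measure N {x} = 0"
    and E: "E \<in> sets M" and "\<delta> > 0"
  shows "\<exists>D\<in>finite_partitions M E. \<forall>I\<in>D. measure N I < \<delta>"
proof -
  interpret N: finite_measure N by (rule N(1))
  have meas: "A \<inter> \<Omega> \<in> sets N" if "open A" for A
    using that borel_\<Omega> by (auto simp: N(2) sets_M_iff)
  have "\<exists>U. open U \<and> x \<in> U \<and> measure N (U \<inter> \<Omega>) < \<delta>" for x
  proof -
    have "(\<lambda>n. measure N (ball x (inverse (Suc n)) \<inter> \<Omega>)) \<longlonglongrightarrow> measure N (\<Inter>n. ball x (inverse (Suc n)) \<inter> \<Omega>)"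
    proof (rule N.finite_Lim_measure_decseq)
      show "range (\<lambda>n. ball x (inverse (Suc n)) \<inter> \<Omega>) \<subseteq> sets N" using meas by auto
      show "decseq (\<lambda>n. ball x (inverse (Suc n)) \<inter> \<Omega>)"
        unfolding decseq_def by (intro allI impI Int_mono subset_ball le_imp_inverse_le) auto
    qed
    moreover have "(\<Inter>n. ball x (inverse (Suc n)) \<inter> \<Omega>) = {x} \<inter> \<Omega>"
    proof -
      have "y = x" if "\<And>n. dist x y < inverse (Suc n)" for y
      proof (rule ccontr)
        assume "y \<noteq> x"
        then obtain n where "inverse (real (Suc n)) < dist x y" using reals_Archimedean[of "dist x y"] by auto
        then show False using that[of n] by simp
      qed
      then show ?thesis by auto
    qed
    moreover have "measure N ({x} \<inter> \<Omega>) = 0" using N(3) by (cases "x \<in> \<Omega>") auto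
    ultimately have "(\<lambda>n. measure N (ball x (inverse (Suc n)) \<inter> \<Omega>)) \<longlonglongrightarrow> 0" by simp
    then have "\<forall>\<^sub>F n in sequentially. measure N (ball x (inverse (Suc n)) \<inter> \<Omega>) < \<delta>"
      using \<open>\<delta> > 0\<close> by (rule order_tendstoD)
    then obtain n where "measure N (ball x (inverse (Suc n)) \<inter> \<Omega>) < \<delta>"
      by (meson eventually_happens trivial_limit_sequentially)
    then show ?thesis by (intro exI[of _ "ball x (inverse (Suc n))"]) auto
  qed
  then obtain U where U: "\<And>x. open (U x)" "\<And>x. x \<in> U x" "\<And>x. measure N (U x \<inter> \<Omega>) < \<delta>" by metis
  obtain \<F> where \<F>: "\<F> \<subseteq> range U" "countable \<F>" "\<Union>\<F> = \<Union>(range U)"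
    using Lindelof[of "range U"] U(1) by auto
  have "\<Union>\<F> = UNIV" using \<F>(3) U(2) by auto
  then have "\<F> \<noteq> {}" by auto
  define V where "V = from_nat_into \<F>"
  have V: "open (V n)" "measure N (V n \<inter> \<Omega>) < \<delta>" for n
    using from_nat_into[OF \<open>\<F> \<noteq> {}\<close>, of n] \<F>(1) U unfolding V_def by auto
  have V_UN: "(\<Union>n. V n) = UNIV"
    using range_from_nat_into[OF \<open>\<F> \<noteq> {}\<close> \<F>(2)] \<open>\<Union>\<F> = UNIV\<close> by (simp add: V_def)
  define W where "W n = E \<inter> disjointed V n" for n
  have dV: "disjointed V n \<in> sets borel" for n
    using sets.range_disjointed_sets[of V borel] V(1) by (auto simp: image_subset_iff)
  then have W: "W n \<in> sets M" for n
    using E by (auto simp: W_def sets_M_iff)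
  have W_small: "measure N (W n) < \<delta>" for n
  proof -
    have "measure N (W n) \<le> measure N (V n \<inter> \<Omega>)"
      using meas[OF V(1)] E disjointed_subset[of V n]
      by (intro N.finite_measure_mono) (auto simp: W_def sets_M_iff)
    then show ?thesis using V(2)[of n] by simp
  qed
  \<comment> \<open>The remainders decrease to the empty set, so one of them is small enough to be a
    block itself.\<close>
  define R where "R n = E - (\<Union>i<n. W i)" for n
  have R: "R n \<in> sets M" for n
    using E W by (auto simp: R_def)
  have "(\<lambda>n. measure N (R n)) \<longlonglongrightarrow> measure N (\<Inter>n. R n)"
    using R N(2) by (intro N.finite_Lim_measure_decseq) (auto simp: decseq_def R_def)
  moreover have "(\<Inter>n. R n) = {}"
  proof -
    have "E \<subseteq> (\<Union>n. W n)" using UN_disjointed_eq[of V] V_UN by (auto simp: W_def)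
    then show ?thesis by (auto simp: R_def)
  qed
  ultimately have "(\<lambda>n. measure N (R n)) \<longlonglongrightarrow> 0" by simp
  then have "\<forall>\<^sub>F n in sequentially. measure N (R n) < \<delta>"
    using \<open>\<delta> > 0\<close> by (rule order_tendstoD)
  then obtain n where n: "measure N (R n) < \<delta>"
    by (meson eventually_happens trivial_limit_sequentially)
  have disj: "W i \<inter> W j = {}" if "i \<noteq> j" for i j
    using disjoint_family_disjointed[of V] that by (auto simp: disjoint_family_on_def W_def)
  define D where "D = insert (R n) (W ` {..<n}) - {{}}"
  have "D \<in> finite_partitions M E"
  proof (rule finite_partitionsI)
    have "\<Union>D = R n \<union> (\<Union>i<n. W i)" unfolding D_def by auto
    moreover have "(\<Union>i<n. W i) \<subseteq> E" by (auto simp: W_def)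
    ultimately show "\<Union>D = E" unfolding R_def by blast
    show "disjoint D"
      unfolding disjoint_def
    proof (intro ballI impI)
      fix A B assume AB: "A \<in> D" "B \<in> D" "A \<noteq> B"
      have "A = R n \<or> (\<exists>i<n. A = W i)" "B = R n \<or> (\<exists>i<n. B = W i)"
        using AB unfolding D_def by auto
      moreover have "R n \<inter> W i = {}" "W i \<inter> R n = {}" if "i < n" for i
        using that by (auto simp: R_def)
      ultimately show "A \<inter> B = {}" using disj AB(3) by metis
    qed
  qed (use R W in \<open>auto simp: D_def\<close>)
  moreover have "\<forall>I\<in>D. measure N I < \<delta>"
    using n W_small by (auto simp: D_def)
  ultimately show ?thesis by blast
qed

text \<open>A singleton cannot be split, so nonatomicity forces zero mass on points; conversely,
  zero mass on points gives arbitrarily fine partitions. In this form closure under sums is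
  immediate.\<close>

lemma NA_pos_iff:
  "\<mu> \<in> NA_pos M \<longleftrightarrow> signed_measure M \<mu> \<and> (\<forall>E\<in>sets M. 0 \<le> \<mu> E) \<and> (\<forall>x. \<mu> {x} = 0)"
proof
  assume \<mu>: "\<mu> \<in> NA_pos M"
  have "\<mu> {x} = 0" for x
  proof (rule ccontr)
    assume *: "\<mu> {x} \<noteq> 0"
    then have "{x} \<in> sets M"
      using \<mu> by (auto simp: NA_pos_def NA_def signed_measure_def game_def)
    then obtain F where "F \<subseteq> {x}" "\<mu> F \<noteq> 0" "\<mu> ({x} - F) \<noteq> 0"
      using \<mu> * unfolding NA_pos_def NA_def nonatomic_def by blast
    moreover have "\<mu> {} = 0" using \<mu> signed_measure_empty by (auto simp: NA_pos_def NA_def)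
    ultimately show False by (auto simp: subset_singleton_iff)
  qed
  with \<mu> show "signed_measure M \<mu> \<and> (\<forall>E\<in>sets M. 0 \<le> \<mu> E) \<and> (\<forall>x. \<mu> {x} = 0)"
    by (simp add: NA_pos_def NA_def)
next
  assume *: "signed_measure M \<mu> \<and> (\<forall>E\<in>sets M. 0 \<le> \<mu> E) \<and> (\<forall>x. \<mu> {x} = 0)"
  then obtain N where N: "finite_measure N" "sets N = sets M" "\<mu> = measure N"
    using nonneg_signed_measure_imp_measure by blast
  have "nonatomic M \<mu>"
  proof (rule nonatomic_if_arbitrarily_fine)
    show "additive (sets M) \<mu>" "\<mu> {} = 0"
      using * additive_signed_measure signed_measure_empty by blast+
    show "\<exists>D\<in>finite_partitions M E. \<forall>I\<in>D. \<bar>\<mu> I\<bar> < \<epsilon>" if "E \<in> sets M" "\<epsilon> > 0" for E \<epsilon>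
      using diffuse_imp_arbitrarily_fine[OF N(1,2) _ that] * by (simp add: N(3))
  qed
  with * show "\<mu> \<in> NA_pos M" by (simp add: NA_pos_def NA_def)
qed

end

section \<open>The Burkill-Cesari integral\<close>

text \<open>The \<open>0\<close> inserted in \<open>mesh\<close> lies below any positive bound, so
  the mesh can be tested block by block.\<close>

lemma mesh_less_iff:
  assumes "finite D" "\<delta> > 0"
  shows "mesh \<kappa> D < \<delta> \<longleftrightarrow> (\<forall>I\<in>D. \<kappa> I < \<delta>)"
  using assms by (simp add: mesh_def)

lemma has_BC_integral_atD:
  assumes "has_BC_integral_at M \<kappa> \<nu> E l" "\<epsilon> > 0"
  obtains \<delta> where "\<delta> > 0"
    "\<And>D. D \<in> finite_partitions M E \<Longrightarrow> (\<And>I. I \<in> D \<Longrightarrow> \<kappa> I < \<delta>) \<Longrightarrow> \<bar>(\<Sum>I\<in>D. \<nu> I) - l\<bar> < \<epsilon>"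
proof -
  from assms obtain \<delta> where \<delta>: "\<delta> > 0"
    "\<And>D. D \<in> finite_partitions M E \<Longrightarrow> mesh \<kappa> D < \<delta> \<Longrightarrow> \<bar>(\<Sum>I\<in>D. \<nu> I) - l\<bar> < \<epsilon>"
    unfolding has_BC_integral_at_def by blast
  then show ?thesis
    using that[of \<delta>] mesh_less_iff[OF finite_partitionsD(1) \<delta>(1)] by blast
qed

lemma has_BC_integral_atI:
  assumes "\<And>\<epsilon>. \<epsilon> > 0 \<Longrightarrow> \<exists>\<delta>>0. \<forall>D\<in>finite_partitions M E.
    (\<forall>I\<in>D. \<kappa> I < \<delta>) \<longrightarrow> \<bar>(\<Sum>I\<in>D. \<nu> I) - l\<bar> < \<epsilon>"
  shows "has_BC_integral_at M \<kappa> \<nu> E l"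
  unfolding has_BC_integral_at_def
proof (intro allI impI)
  fix \<epsilon> :: real assume "\<epsilon> > 0"
  then obtain \<delta> where \<delta>: "\<delta> > 0"
    "\<forall>D\<in>finite_partitions M E. (\<forall>I\<in>D. \<kappa> I < \<delta>) \<longrightarrow> \<bar>(\<Sum>I\<in>D. \<nu> I) - l\<bar> < \<epsilon>"
    using assms by blast
  then show "\<exists>\<delta>>0. \<forall>D\<in>finite_partitions M E. mesh \<kappa> D < \<delta> \<longrightarrow> \<bar>(\<Sum>I\<in>D. \<nu> I) - l\<bar> < \<epsilon>"
    using mesh_less_iff[OF finite_partitionsD(1) \<delta>(1)] by (intro exI[of _ \<delta>]) blast
qed

text \<open>A larger control measure admits fewer partitions at the same threshold; a common control
  can thus replace several individual ones.\<close>

lemma has_BC_integral_at_mono: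
  assumes "has_BC_integral_at M \<kappa> \<nu> E l" "\<And>I. I \<in> sets M \<Longrightarrow> \<kappa> I \<le> \<kappa>' I"
  shows "has_BC_integral_at M \<kappa>' \<nu> E l"
proof (rule has_BC_integral_atI)
  fix \<epsilon> :: real assume "\<epsilon> > 0"
  with assms(1) obtain \<delta> where \<delta>: "\<delta> > 0"
    "\<And>D. D \<in> finite_partitions M E \<Longrightarrow> (\<And>I. I \<in> D \<Longrightarrow> \<kappa> I < \<delta>) \<Longrightarrow> \<bar>(\<Sum>I\<in>D. \<nu> I) - l\<bar> < \<epsilon>"
    by (rule has_BC_integral_atD) blast
  have "\<bar>(\<Sum>I\<in>D. \<nu> I) - l\<bar> < \<epsilon>" if "D \<in> finite_partitions M E" "\<forall>I\<in>D. \<kappa>' I < \<delta>" for D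
    using that assms(2) finite_partitionsD(2)[OF that(1)]
    by (intro \<delta>(2)) (auto intro: le_less_trans)
  with \<delta>(1) show "\<exists>\<delta>>0. \<forall>D\<in>finite_partitions M E. (\<forall>I\<in>D. \<kappa>' I < \<delta>) \<longrightarrow> \<bar>(\<Sum>I\<in>D. \<nu> I) - l\<bar> < \<epsilon>"
    by blast
qed

lemma has_BC_integral_at_add:
  assumes "has_BC_integral_at M \<kappa> \<nu> E l" "has_BC_integral_at M \<kappa> \<nu>' E l'"
  shows "has_BC_integral_at M \<kappa> (\<lambda>I. \<nu> I + \<nu>' I) E (l + l')"
proof (rule has_BC_integral_atI)
  fix \<epsilon> :: real assume "\<epsilon> > 0"
  then have "\<epsilon> / 2 > 0" by simp
  from assms(1) this obtain \<delta> where \<delta>: "\<delta> > 0"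
    "\<And>D. D \<in> finite_partitions M E \<Longrightarrow> (\<And>I. I \<in> D \<Longrightarrow> \<kappa> I < \<delta>) \<Longrightarrow> \<bar>(\<Sum>I\<in>D. \<nu> I) - l\<bar> < \<epsilon> / 2"
    by (rule has_BC_integral_atD) blast
  from assms(2) \<open>\<epsilon> / 2 > 0\<close> obtain \<delta>' where \<delta>': "\<delta>' > 0"
    "\<And>D. D \<in> finite_partitions M E \<Longrightarrow> (\<And>I. I \<in> D \<Longrightarrow> \<kappa> I < \<delta>') \<Longrightarrow> \<bar>(\<Sum>I\<in>D. \<nu>' I) - l'\<bar> < \<epsilon> / 2"
    by (rule has_BC_integral_atD) blast
  have "\<bar>(\<Sum>I\<in>D. \<nu> I + \<nu>' I) - (l + l')\<bar> < \<epsilon>"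
    if "D \<in> finite_partitions M E" "\<forall>I\<in>D. \<kappa> I < min \<delta> \<delta>'" for D
  proof -
    have "\<bar>(\<Sum>I\<in>D. \<nu> I) - l\<bar> < \<epsilon> / 2" "\<bar>(\<Sum>I\<in>D. \<nu>' I) - l'\<bar> < \<epsilon> / 2"
      using \<delta>(2)[OF that(1)] \<delta>'(2)[OF that(1)] that(2) by auto
    then show ?thesis unfolding sum.distrib by (smt (verit) field_sum_of_halves)
  qed
  then show "\<exists>\<delta>>0. \<forall>D\<in>finite_partitions M E. (\<forall>I\<in>D. \<kappa> I < \<delta>) \<longrightarrow> \<bar>(\<Sum>I\<in>D. \<nu> I + \<nu>' I) - (l + l')\<bar> < \<epsilon>"
    using \<delta>(1) \<delta>'(1) by (intro exI[of _ "min \<delta> \<delta>'"]) auto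
qed

lemma has_BC_integral_at_cmult:
  assumes "has_BC_integral_at M \<kappa> \<nu> E l"
  shows "has_BC_integral_at M \<kappa> (\<lambda>I. c * \<nu> I) E (c * l)"
proof (rule has_BC_integral_atI)
  fix \<epsilon> :: real assume "\<epsilon> > 0"
  \<comment> \<open>Adding 1 keeps the denominator positive when \<open>c\<close> is 0.\<close>
  then have "\<epsilon> / (\<bar>c\<bar> + 1) > 0" by simp
  from assms this obtain \<delta> where \<delta>: "\<delta> > 0"
    "\<And>D. D \<in> finite_partitions M E \<Longrightarrow> (\<And>I. I \<in> D \<Longrightarrow> \<kappa> I < \<delta>) \<Longrightarrow> \<bar>(\<Sum>I\<in>D. \<nu> I) - l\<bar> < \<epsilon> / (\<bar>c\<bar> + 1)"
    by (rule has_BC_integral_atD) blast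
  have "\<bar>(\<Sum>I\<in>D. c * \<nu> I) - c * l\<bar> < \<epsilon>"
    if "D \<in> finite_partitions M E" "\<forall>I\<in>D. \<kappa> I < \<delta>" for D
  proof -
    have "\<bar>(\<Sum>I\<in>D. c * \<nu> I) - c * l\<bar> = \<bar>c\<bar> * \<bar>(\<Sum>I\<in>D. \<nu> I) - l\<bar>"
      by (simp add: abs_mult flip: sum_distrib_left right_diff_distrib)
    also have "\<dots> \<le> (\<bar>c\<bar> + 1) * \<bar>(\<Sum>I\<in>D. \<nu> I) - l\<bar>"
      by (intro mult_right_mono) auto
    also have "\<dots> < \<epsilon>"
      using \<delta>(2)[OF that(1)] that(2) by (simp add: pos_less_divide_eq mult.commute)
    finally show ?thesis .
  qed
  with \<delta>(1) show "\<exists>\<delta>>0. \<forall>D\<in>finite_partitions M E. (\<forall>I\<in>D. \<kappa> I < \<delta>) \<longrightarrow> \<bar>(\<Sum>I\<in>D. c * \<nu> I) - c * l\<bar> < \<epsilon>"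
    by blast
qed

lemma has_BC_integral_at_sum:
  assumes "finite J" "\<And>j. j \<in> J \<Longrightarrow> has_BC_integral_at M \<kappa> (\<nu> j) E (l j)"
  shows "has_BC_integral_at M \<kappa> (\<lambda>I. \<Sum>j\<in>J. \<nu> j I) E (\<Sum>j\<in>J. l j)"
  using assms
proof induction
  case empty
  show ?case by (rule has_BC_integral_atI) (auto intro!: exI[of _ 1])
next
  case (insert j J)
  then show ?case by (simp add: has_BC_integral_at_add)
qed

lemma has_BC_integral_at_empty: "has_BC_integral_at M \<kappa> \<nu> {} 0"
  by (rule has_BC_integral_atI)
    (auto intro!: exI[of _ 1] simp: finite_partitions_def partition_on_empty)

lemma finite_partitions_Un:
  assumes "D \<in> finite_partitions M A" "D' \<in> finite_partitions M B" "A \<inter> B = {}"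
  shows "D \<union> D' \<in> finite_partitions M (A \<union> B)"
    and "(\<Sum>I\<in>D \<union> D'. f I) = (\<Sum>I\<in>D. f I) + (\<Sum>I\<in>D'. f I :: real)"
proof -
  note D = finite_partitionsD[OF assms(1)] and D' = finite_partitionsD[OF assms(2)]
  show "D \<union> D' \<in> finite_partitions M (A \<union> B)"
  proof (rule finite_partitionsI)
    show "disjoint (D \<union> D')"
      using D(3,4) D'(3,4) assms(3) unfolding disjoint_def by blast
  qed (use D D' in auto)
  \<comment> \<open>A common block would lie in \<open>A \<inter> B\<close> and so be empty, which
    partitions exclude; hence no term is counted twice.\<close>
  have "I \<notin> D'" if "I \<in> D" for I
  proof
    assume "I \<in> D'"
    then have "I \<subseteq> A \<inter> B" using that D(3) D'(3) by blast
    then show False using assms(3) that D(5) by auto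
  qed
  then have "D \<inter> D' = {}" by blast
  then show "(\<Sum>I\<in>D \<union> D'. f I) = (\<Sum>I\<in>D. f I) + (\<Sum>I\<in>D'. f I)"
    using D(1) D'(1) by (simp add: sum.union_disjoint)
qed

section \<open>Countable additivity from absolute continuity\<close>

lemma signed_measure_add:
  assumes "signed_measure M \<mu>" "signed_measure M \<mu>'"
  shows "signed_measure M (\<lambda>E. \<mu> E + \<mu>' E)"
  using assms by (auto simp: signed_measure_def game_def intro: sums_add)

lemma signed_measure_zero: "signed_measure M (\<lambda>E. 0)"
  by (simp add: signed_measure_def game_def)

text \<open>By finite additivity the value on a tail of the union is the error of the partial sum.
  The tails decrease to the empty set, so their measure tends to 0, and by absolute continuity so
  does \<phi>.\<close>

lemma signed_measure_if_abs_cont: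
  assumes "game M \<phi>" and add: "additive (sets M) \<phi>"
    and N: "finite_measure N" "sets N = sets M"
    and cont: "\<And>\<epsilon>. \<epsilon> > 0 \<Longrightarrow> \<exists>\<delta>>0. \<forall>E\<in>sets M. measure N E < \<delta> \<longrightarrow> \<bar>\<phi> E\<bar> < \<epsilon>"
  shows "signed_measure M \<phi>"
  unfolding signed_measure_def
proof (intro conjI allI impI)
  interpret N: finite_measure N by (rule N(1))
  fix A :: "nat \<Rightarrow> _" assume A: "range A \<subseteq> sets M" "disjoint_family A"
  define R where "R n = (\<Union>i. A i) - (\<Union>i<n. A i)" for n
  have R: "R n \<in> sets M" for n using A(1) by (auto simp: R_def)
  have "(\<lambda>n. measure N (R n)) \<longlonglongrightarrow> measure N (\<Inter>n. R n)"
    using R N(2) by (intro N.finite_Lim_measure_decseq) (auto simp: decseq_def R_def)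
  moreover have "(\<Inter>n. R n) = {}" by (auto simp: R_def)
  ultimately have lim: "(\<lambda>n. measure N (R n)) \<longlonglongrightarrow> 0" by simp
  have "(\<lambda>n. \<phi> (R n)) \<longlonglongrightarrow> 0"
  proof (rule tendstoI)
    fix \<epsilon> :: real assume "\<epsilon> > 0"
    then obtain \<delta> where \<delta>: "\<delta> > 0" "\<And>E. E \<in> sets M \<Longrightarrow> measure N E < \<delta> \<Longrightarrow> \<bar>\<phi> E\<bar> < \<epsilon>"
      using cont by blast
    have "\<forall>\<^sub>F n in sequentially. measure N (R n) < \<delta>" using lim \<delta>(1) by (rule order_tendstoD)
    then show "\<forall>\<^sub>F n in sequentially. dist (\<phi> (R n)) 0 < \<epsilon>"
      by eventually_elim (use \<delta>(2) R in auto)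
  qed
  moreover have "\<phi> (R n) = \<phi> (\<Union>i. A i) - (\<Sum>i<n. \<phi> (A i))" for n
  proof -
    have "(\<Sum>i<n. \<phi> (A i)) = \<phi> (\<Union>i<n. A i)"
      using A assms(1) by (intro additive_sum_disjoint[OF add]) (auto simp: game_def disjoint_family_on_def)
    moreover have "\<phi> (R n) = \<phi> (\<Union>i. A i) - \<phi> (\<Union>i<n. A i)"
      unfolding R_def using A(1) by (intro additive_Diff[OF add]) auto
    ultimately show ?thesis by simp
  qed
  ultimately have "(\<lambda>n. \<phi> (\<Union>i. A i) - (\<Sum>i<n. \<phi> (A i))) \<longlonglongrightarrow> 0" by simp
  then have "(\<lambda>n. \<phi> (\<Union>i. A i) - (\<phi> (\<Union>i. A i) - (\<Sum>i<n. \<phi> (A i)))) \<longlonglongrightarrow> \<phi> (\<Union>i. A i) - 0"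
    by (intro tendsto_diff tendsto_const)
  then show "(\<lambda>i. \<phi> (A i)) sums \<phi> (\<Union>i. A i)" by (simp add: sums_def)
qed (rule assms(1))

text \<open>Puts an arbitrary measurable set at the end of a link that starts at the empty
  set.\<close>

lemma chains_two_links:
  assumes "E \<in> sets M"
  shows "{({}, E), (E, space M)} \<in> chains M"
proof -
  define S where "S = (\<lambda>i::nat. if i = 0 then {} else if i = 1 then E else space M)"
  have "{({}, E), (E, space M)} = {(S i, S (Suc i)) |i. i < 2}"
  proof -
    have "{(S i, S (Suc i)) |i. i < 2} = (\<lambda>i. (S i, S (Suc i))) ` {0, 1}"
      unfolding setcompr_eq_image by (rule image_cong) (auto simp: less_2_cases_iff)
    then show ?thesis by (simp add: S_def)
  qed
  moreover have "S 0 = {} \<and> S 2 = space M \<and> (\<forall>i\<le>2. S i \<in> sets M) \<and> (\<forall>i<2. S i \<subseteq> S (Suc i))"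
    using assms sets.sets_into_space[OF assms] by (auto simp: S_def)
  ultimately show ?thesis unfolding chains_def by blast
qed

text \<open>The single link \<open>({}, E)\<close> is a subchain, and the variations along it are
  the absolute values at \<open>E\<close>.\<close>

lemma abs_cont4_imp_small:
  assumes "abs_cont4 M \<nu> \<mu>" "\<nu> {} = 0" "\<mu> {} = 0" "\<epsilon> > 0"
  obtains \<delta> where "\<delta> > 0" "\<And>E. E \<in> sets M \<Longrightarrow> \<bar>\<mu> E\<bar> < \<delta> \<Longrightarrow> \<bar>\<nu> E\<bar> < \<epsilon>"
proof -
  obtain \<delta> where \<delta>: "\<delta> > 0"
    "\<forall>\<Lambda>\<in>subchains M. variation_on \<mu> \<Lambda> < \<delta> \<longrightarrow> variation_on \<nu> \<Lambda> < \<epsilon>"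
    using assms(1,4) unfolding abs_cont4_def by blast
  have "\<bar>\<nu> E\<bar> < \<epsilon>" if "E \<in> sets M" "\<bar>\<mu> E\<bar> < \<delta>" for E
  proof -
    have "{({}, E)} \<in> subchains M"
      unfolding subchains_def using chains_two_links[OF that(1)] by blast
    then show ?thesis using \<delta>(2) that(2) assms(2,3) by (fastforce simp: variation_on_def)
  qed
  with \<delta>(1) that show ?thesis by blast
qed

section \<open>Uniqueness, additivity and range of the integral\<close>

context borel_subspace
begin

lemma NA_pos_add:
  assumes "\<kappa> \<in> NA_pos M" "\<kappa>' \<in> NA_pos M"
  shows "(\<lambda>E. \<kappa> E + \<kappa>' E) \<in> NA_pos M"
  using assms by (auto simp: NA_pos_iff intro: signed_measure_add)

lemma NA_pos_sum:
  assumes "finite J" "\<And>j. j \<in> J \<Longrightarrow> \<kappa> j \<in> NA_pos M"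
  shows "(\<lambda>E. \<Sum>j\<in>J. \<kappa> j E) \<in> NA_pos M"
  using assms
proof induction
  case empty
  show ?case by (simp add: NA_pos_iff signed_measure_zero)
next
  case (insert j J)
  then show ?case using NA_pos_add[of "\<kappa> j" "\<lambda>E. \<Sum>j\<in>J. \<kappa> j E"] by simp
qed

lemma NA_pos_arbitrarily_fine:
  assumes "\<kappa> \<in> NA_pos M" "E \<in> sets M" "\<delta> > 0"
  obtains D where "D \<in> finite_partitions M E" "\<And>I. I \<in> D \<Longrightarrow> \<kappa> I < \<delta>"
proof -
  obtain N where "finite_measure N" "sets N = sets M" "\<kappa> = measure N"
    using assms(1) nonneg_signed_measure_imp_measure[of M \<kappa>] unfolding NA_pos_iff by blast
  then show ?thesis
    using diffuse_imp_arbitrarily_fine[of N E \<delta>] assms that unfolding NA_pos_iff by blast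
qed

text \<open>A partition that is fine for the sum of the two control measures is fine for each, so
  one and the same sum is close to both limits.\<close>

lemma has_BC_integral_at_unique:
  assumes "has_BC_integral_at M \<kappa> \<nu> E l" "has_BC_integral_at M \<kappa>' \<nu> E l'"
    and \<kappa>: "\<kappa> \<in> NA_pos M" "\<kappa>' \<in> NA_pos M" and E: "E \<in> sets M"
  shows "l = l'"
proof (rule ccontr)
  assume "l \<noteq> l'"
  then have e: "\<bar>l - l'\<bar> / 2 > 0" by simp
  from assms(1) e obtain \<delta> where \<delta>: "\<delta> > 0"
    "\<And>D. D \<in> finite_partitions M E \<Longrightarrow> (\<And>I. I \<in> D \<Longrightarrow> \<kappa> I < \<delta>) \<Longrightarrow> \<bar>(\<Sum>I\<in>D. \<nu> I) - l\<bar> < \<bar>l - l'\<bar> / 2"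
    by (rule has_BC_integral_atD) blast
  from assms(2) e obtain \<delta>' where \<delta>': "\<delta>' > 0"
    "\<And>D. D \<in> finite_partitions M E \<Longrightarrow> (\<And>I. I \<in> D \<Longrightarrow> \<kappa>' I < \<delta>') \<Longrightarrow> \<bar>(\<Sum>I\<in>D. \<nu> I) - l'\<bar> < \<bar>l - l'\<bar> / 2"
    by (rule has_BC_integral_atD) blast
  obtain D where D: "D \<in> finite_partitions M E" "\<And>I. I \<in> D \<Longrightarrow> \<kappa> I + \<kappa>' I < min \<delta> \<delta>'"
    using NA_pos_arbitrarily_fine[OF NA_pos_add[OF \<kappa>] E, of "min \<delta> \<delta>'"] \<delta>(1) \<delta>'(1) by auto
  have "\<kappa> I < \<delta> \<and> \<kappa>' I < \<delta>'" if "I \<in> D" for I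
  proof -
    have "I \<in> sets M" using finite_partitionsD(2)[OF D(1)] that by blast
    then have "0 \<le> \<kappa> I" "0 \<le> \<kappa>' I" using \<kappa> by (auto simp: NA_pos_def)
    then show ?thesis using D(2)[OF that] by simp
  qed
  then have "\<bar>(\<Sum>I\<in>D. \<nu> I) - l\<bar> < \<bar>l - l'\<bar> / 2" "\<bar>(\<Sum>I\<in>D. \<nu> I) - l'\<bar> < \<bar>l - l'\<bar> / 2"
    using \<delta>(2) \<delta>'(2) D(1) by blast+
  then show False by (smt (verit) field_sum_of_halves)
qed

lemma BC_integral_eqI:
  assumes "\<kappa> \<in> NA_pos M" "BC_integrable M \<kappa> \<nu>" "has_BC_integral_at M \<kappa> \<nu> E l" "E \<in> sets M"
  shows "BC_integral M \<nu> E = l"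
  unfolding BC_integral_def using assms has_BC_integral_at_unique
  by (auto intro!: the_equality)

text \<open>Fine partitions of the two parts combine to a fine partition of the union, whose sum is
  the sum of theirs. Three approximations occur, hence the thirds.\<close>

lemma has_BC_integral_at_Un:
  assumes "has_BC_integral_at M \<kappa> \<nu> A a" "has_BC_integral_at M \<kappa> \<nu> B b"
    "has_BC_integral_at M \<kappa> \<nu> (A \<union> B) l"
    and \<kappa>: "\<kappa> \<in> NA_pos M" and AB: "A \<in> sets M" "B \<in> sets M" "A \<inter> B = {}"
  shows "l = a + b"
proof (rule ccontr)
  assume "l \<noteq> a + b"
  define e where "e = \<bar>l - (a + b)\<bar> / 3"
  have e: "e > 0" "3 * e = \<bar>l - (a + b)\<bar>" using \<open>l \<noteq> a + b\<close> by (simp_all add: e_def)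
  from assms(1) e(1) obtain \<delta>1 where \<delta>1: "\<delta>1 > 0"
    "\<And>D. D \<in> finite_partitions M A \<Longrightarrow> (\<And>I. I \<in> D \<Longrightarrow> \<kappa> I < \<delta>1) \<Longrightarrow> \<bar>(\<Sum>I\<in>D. \<nu> I) - a\<bar> < e"
    by (rule has_BC_integral_atD) blast
  from assms(2) e(1) obtain \<delta>2 where \<delta>2: "\<delta>2 > 0"
    "\<And>D. D \<in> finite_partitions M B \<Longrightarrow> (\<And>I. I \<in> D \<Longrightarrow> \<kappa> I < \<delta>2) \<Longrightarrow> \<bar>(\<Sum>I\<in>D. \<nu> I) - b\<bar> < e"
    by (rule has_BC_integral_atD) blast
  from assms(3) e(1) obtain \<delta>3 where \<delta>3: "\<delta>3 > 0"
    "\<And>D. D \<in> finite_partitions M (A \<union> B) \<Longrightarrow> (\<And>I. I \<in> D \<Longrightarrow> \<kappa> I < \<delta>3) \<Longrightarrow> \<bar>(\<Sum>I\<in>D. \<nu> I) - l\<bar> < e"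
    by (rule has_BC_integral_atD) blast
  define \<delta> where "\<delta> = min \<delta>1 (min \<delta>2 \<delta>3)"
  have \<delta>: "\<delta> > 0" "\<delta> \<le> \<delta>1" "\<delta> \<le> \<delta>2" "\<delta> \<le> \<delta>3" using \<delta>1(1) \<delta>2(1) \<delta>3(1) by (auto simp: \<delta>_def)
  obtain D where D: "D \<in> finite_partitions M A" "\<And>I. I \<in> D \<Longrightarrow> \<kappa> I < \<delta>"
    using NA_pos_arbitrarily_fine[OF \<kappa> AB(1) \<delta>(1)] by blast
  obtain D' where D': "D' \<in> finite_partitions M B" "\<And>I. I \<in> D' \<Longrightarrow> \<kappa> I < \<delta>"
    using NA_pos_arbitrarily_fine[OF \<kappa> AB(2) \<delta>(1)] by blast
  have "\<bar>(\<Sum>I\<in>D. \<nu> I) - a\<bar> < e" using D \<delta>(2) by (intro \<delta>1(2)) (auto intro: less_le_trans)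
  moreover have "\<bar>(\<Sum>I\<in>D'. \<nu> I) - b\<bar> < e" using D' \<delta>(3) by (intro \<delta>2(2)) (auto intro: less_le_trans)
  moreover have "\<bar>(\<Sum>I\<in>D \<union> D'. \<nu> I) - l\<bar> < e"
    using D D' \<delta>(4) finite_partitions_Un(1)[OF D(1) D'(1) AB(3)]
    by (intro \<delta>3(2)) (auto intro: less_le_trans)
  ultimately show False
    unfolding finite_partitions_Un(2)[OF D(1) D'(1) AB(3)] using e(2) by (smt (verit))
qed

text \<open>A small set \<open>E\<close> may serve as a single block of a fine partition of the whole space, so that
  \<open>\<nu> E\<close> and the integral over \<open>E\<close> nearly agree; this is uniform in \<open>E\<close>.\<close>

lemma BC_integral_uniformly_close:
  assumes \<kappa>: "\<kappa> \<in> NA_pos M" and "\<nu> {} = 0"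
    and \<phi>: "\<And>E. E \<in> sets M \<Longrightarrow> has_BC_integral_at M \<kappa> \<nu> E (\<phi> E)" and "\<epsilon> > 0"
  obtains \<delta> where "\<delta> > 0" "\<And>E. E \<in> sets M \<Longrightarrow> \<kappa> E < \<delta> \<Longrightarrow> \<bar>\<nu> E - \<phi> E\<bar> < \<epsilon>"
proof -
  define e where "e = \<epsilon> / 3"
  have e: "e > 0" "3 * e = \<epsilon>" using \<open>\<epsilon> > 0\<close> by (simp_all add: e_def)
  from \<phi>[OF sets.top] e(1) obtain \<delta> where \<delta>: "\<delta> > 0"
    "\<And>D. D \<in> finite_partitions M (space M) \<Longrightarrow> (\<And>I. I \<in> D \<Longrightarrow> \<kappa> I < \<delta>) \<Longrightarrow>
      \<bar>(\<Sum>I\<in>D. \<nu> I) - \<phi> (space M)\<bar> < e"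
    by (rule has_BC_integral_atD) blast
  have "\<bar>\<nu> E - \<phi> E\<bar> < \<epsilon>" if E: "E \<in> sets M" "\<kappa> E < \<delta>" for E
  proof -
    from \<phi>[OF E(1)] e(1) obtain \<delta>' where \<delta>': "\<delta>' > 0"
      "\<And>D. D \<in> finite_partitions M E \<Longrightarrow> (\<And>I. I \<in> D \<Longrightarrow> \<kappa> I < \<delta>') \<Longrightarrow> \<bar>(\<Sum>I\<in>D. \<nu> I) - \<phi> E\<bar> < e"
      by (rule has_BC_integral_atD) blast
    have "min \<delta> \<delta>' > 0" using \<delta>(1) \<delta>'(1) by simp
    then obtain D where D: "D \<in> finite_partitions M E" "\<And>I. I \<in> D \<Longrightarrow> \<kappa> I < min \<delta> \<delta>'"
      using NA_pos_arbitrarily_fine[OF \<kappa> E(1)] by blast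
    obtain C where C: "C \<in> finite_partitions M (space M - E)" "\<And>I. I \<in> C \<Longrightarrow> \<kappa> I < \<delta>"
      using NA_pos_arbitrarily_fine[OF \<kappa> _ \<delta>(1), of "space M - E"] E(1) by blast
    \<comment> \<open>Removing the empty block covers the case that \<open>E\<close> is empty, where
      the sum is still \<open>\<nu> E\<close>.\<close>
    define D' where "D' = {E} - {{}}"
    have "(\<Sum>I\<in>D'. \<nu> I) = \<nu> E"
      using \<open>\<nu> {} = 0\<close> by (cases "E = {}") (auto simp: D'_def insert_Diff_if)
    moreover have "D' \<in> finite_partitions M E" "\<And>I. I \<in> D' \<Longrightarrow> \<kappa> I < \<delta>"
      using E \<open>\<nu> {} = 0\<close> by (auto simp: D'_def finite_partitions_def partition_on_def disjoint_def)
    ultimately have D': "D' \<in> finite_partitions M E" "\<And>I. I \<in> D' \<Longrightarrow> \<kappa> I < \<delta>"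
      "(\<Sum>I\<in>D'. \<nu> I) = \<nu> E" by blast+
    have disj: "E \<inter> (space M - E) = {}" and un: "E \<union> (space M - E) = space M"
      using sets.sets_into_space[OF E(1)] by auto
    \<comment> \<open>Both partitions of the whole space contain \<open>C\<close>, and both sums are
      within \<open>e\<close> of \<open>\<phi> (space M)\<close>; subtracting them leaves
      \<open>\<nu> E\<close> within \<open>2 * e\<close> of the sum over \<open>D\<close>.\<close>
    note DC = finite_partitions_Un[OF D(1) C(1) disj, unfolded un]
      and D'C = finite_partitions_Un[OF D'(1) C(1) disj, unfolded un]
    have "\<bar>(\<Sum>I\<in>D \<union> C. \<nu> I) - \<phi> (space M)\<bar> < e"
      using DC(1) D(2) C(2) by (intro \<delta>(2)) auto
    moreover have "\<bar>(\<Sum>I\<in>D' \<union> C. \<nu> I) - \<phi> (space M)\<bar> < e"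
      using D'C(1) D'(2) C(2) by (intro \<delta>(2)) auto
    moreover have "\<bar>(\<Sum>I\<in>D. \<nu> I) - \<phi> E\<bar> < e"
      using D by (intro \<delta>'(2)) auto
    ultimately show ?thesis unfolding DC(2) D'C(2) D'(3) using e(2) by (smt (verit))
  qed
  with \<delta>(1) that show ?thesis by blast
qed

theorem BC_integral_in_NA:
  assumes "\<nu> \<in> BC_AC4 M"
  shows "BC_integral M \<nu> \<in> NA M"
proof -
  obtain \<kappa> \<mu> where \<nu>: "game M \<nu>" and \<kappa>: "\<kappa> \<in> NA_pos M" "BC_integrable M \<kappa> \<nu>"
    and \<mu>: "\<mu> \<in> NA_pos M" "abs_cont4 M \<nu> \<mu>"
    using assms by (auto simp: BC_AC4_def BC_def AC4_def)
  define \<phi> where "\<phi> = BC_integral M \<nu>"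
  have \<phi>: "has_BC_integral_at M \<kappa> \<nu> E (\<phi> E)" if "E \<in> sets M" for E
    using \<kappa> that BC_integral_eqI unfolding \<phi>_def BC_integrable_def by metis
  have game: "game M \<phi>"
    using BC_integral_eqI[OF \<kappa> has_BC_integral_at_empty] by (simp add: game_def \<phi>_def BC_integral_def)
  have add: "additive (sets M) \<phi>"
    unfolding additive_def using has_BC_integral_at_Un[OF \<phi> \<phi> \<phi> \<kappa>(1)] by blast
  \<comment> \<open>\<open>\<kappa>\<close> controls the distance from \<nu> to its integral and
    \<open>\<mu>\<close> controls \<nu>, so their sum controls \<phi>.\<close>
  define \<theta> where "\<theta> = (\<lambda>E. \<kappa> E + \<mu> E)"
  have \<theta>: "\<theta> \<in> NA_pos M" unfolding \<theta>_def by (rule NA_pos_add[OF \<kappa>(1) \<mu>(1)])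
  have cont: "\<exists>\<delta>>0. \<forall>E\<in>sets M. \<theta> E < \<delta> \<longrightarrow> \<bar>\<phi> E\<bar> < \<epsilon>" if "\<epsilon> > 0" for \<epsilon>
  proof -
    have e: "\<epsilon> / 2 > 0" using that by simp
    have "\<nu> {} = 0" "\<mu> {} = 0" using \<nu> \<mu> by (auto simp: game_def NA_pos_iff signed_measure_def)
    from \<mu>(2) this e obtain \<delta>1 where \<delta>1: "\<delta>1 > 0" "\<And>E. E \<in> sets M \<Longrightarrow> \<bar>\<mu> E\<bar> < \<delta>1 \<Longrightarrow> \<bar>\<nu> E\<bar> < \<epsilon> / 2"
      by (rule abs_cont4_imp_small) blast
    from \<kappa>(1) \<open>\<nu> {} = 0\<close> \<phi> e obtain \<delta>2 where \<delta>2: "\<delta>2 > 0"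
      "\<And>E. E \<in> sets M \<Longrightarrow> \<kappa> E < \<delta>2 \<Longrightarrow> \<bar>\<nu> E - \<phi> E\<bar> < \<epsilon> / 2"
      by (rule BC_integral_uniformly_close) blast+
    have "\<bar>\<phi> E\<bar> < \<epsilon>" if "E \<in> sets M" "\<theta> E < min \<delta>1 \<delta>2" for E
    proof -
      have "0 \<le> \<kappa> E" "0 \<le> \<mu> E" using \<kappa>(1) \<mu>(1) that(1) by (auto simp: NA_pos_def)
      then have "\<bar>\<mu> E\<bar> < \<delta>1" "\<kappa> E < \<delta>2" using that(2) by (auto simp: \<theta>_def)
      then have "\<bar>\<nu> E\<bar> < \<epsilon> / 2" "\<bar>\<nu> E - \<phi> E\<bar> < \<epsilon> / 2" using \<delta>1(2) \<delta>2(2) that(1) by blast+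
      then show ?thesis by linarith
    qed
    then show ?thesis using \<delta>1(1) \<delta>2(1) by (intro exI[of _ "min \<delta>1 \<delta>2"]) auto
  qed
  have fine: "\<exists>D\<in>finite_partitions M E. \<forall>I\<in>D. \<bar>\<phi> I\<bar> < \<epsilon>" if E: "E \<in> sets M" "\<epsilon> > 0" for E \<epsilon>
  proof -
    obtain \<delta> where \<delta>: "\<delta> > 0" "\<And>E. E \<in> sets M \<Longrightarrow> \<theta> E < \<delta> \<Longrightarrow> \<bar>\<phi> E\<bar> < \<epsilon>"
      using cont[OF \<open>\<epsilon> > 0\<close>] by blast
    obtain D where D: "D \<in> finite_partitions M E" "\<And>I. I \<in> D \<Longrightarrow> \<theta> I < \<delta>"
      using NA_pos_arbitrarily_fine[OF \<theta> E(1) \<delta>(1)] by blast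
    then show ?thesis using \<delta>(2) finite_partitionsD(2)[OF D(1)] by blast
  qed
  obtain N where N: "finite_measure N" "sets N = sets M" "\<theta> = measure N"
    using \<theta> nonneg_signed_measure_imp_measure[of M \<theta>] unfolding NA_pos_iff by blast
  have "signed_measure M \<phi>"
    by (rule signed_measure_if_abs_cont[OF game add N(1,2)]) (use cont N(3) in auto)
  moreover have "nonatomic M \<phi>"
    using game by (intro nonatomic_if_arbitrarily_fine add fine) (auto simp: game_def)
  ultimately show ?thesis by (simp add: NA_def \<phi>_def)
qed

end

section \<open>Powers of nonatomic measures and discontinuity\<close>

lemma variation_on_le:
  assumes "\<And>S T. (S, T) \<in> \<Lambda> \<Longrightarrow> \<bar>\<nu> T - \<nu> S\<bar> \<le> C * \<bar>\<mu> T - \<mu> S\<bar>"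
  shows "variation_on \<nu> \<Lambda> \<le> C * variation_on \<mu> \<Lambda>"
  unfolding variation_on_def sum_distrib_left using assms by (intro sum_mono) auto

lemma subchains_link:
  assumes "\<Lambda> \<in> subchains M" "(S, T) \<in> \<Lambda>"
  shows "S \<in> sets M" "T \<in> sets M" "S \<subseteq> T"
  using assms by (auto simp: subchains_def chains_def) blast+

text \<open>The Lipschitz bound on inclusions passes to sums over links. The threshold uses
  \<open>C + 1\<close> so that \<open>C = 0\<close> is allowed.\<close>

lemma abs_cont4_if_Lipschitz:
  assumes "\<And>S T. S \<in> sets M \<Longrightarrow> T \<in> sets M \<Longrightarrow> S \<subseteq> T \<Longrightarrow> \<bar>\<nu> T - \<nu> S\<bar> \<le> C * \<bar>\<mu> T - \<mu> S\<bar>"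
    and "C \<ge> 0"
  shows "abs_cont4 M \<nu> \<mu>"
  unfolding abs_cont4_def
proof (intro allI impI)
  fix \<epsilon> :: real assume "\<epsilon> > 0"
  have "variation_on \<nu> \<Lambda> < \<epsilon>" if "\<Lambda> \<in> subchains M" "variation_on \<mu> \<Lambda> < \<epsilon> / (C + 1)" for \<Lambda>
  proof -
    have "0 \<le> variation_on \<mu> \<Lambda>" unfolding variation_on_def by (intro sum_nonneg) auto
    have "variation_on \<nu> \<Lambda> \<le> C * variation_on \<mu> \<Lambda>"
      by (rule variation_on_le) (rule assms(1)[OF subchains_link[OF that(1)]])
    also have "\<dots> \<le> (C + 1) * variation_on \<mu> \<Lambda>"
      using \<open>0 \<le> variation_on \<mu> \<Lambda>\<close> by (intro mult_right_mono) auto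
    also have "\<dots> < \<epsilon>" using that(2) \<open>C \<ge> 0\<close> by (simp add: pos_less_divide_eq mult.commute)
    finally show ?thesis .
  qed
  moreover have "\<epsilon> / (C + 1) > 0" using \<open>\<epsilon> > 0\<close> \<open>C \<ge> 0\<close> by simp
  ultimately show "\<exists>\<delta>>0. \<forall>\<Lambda>\<in>subchains M. variation_on \<mu> \<Lambda> < \<delta> \<longrightarrow> variation_on \<nu> \<Lambda> < \<epsilon>"
    by blast
qed

lemma variation_norm_mono_le:
  assumes "\<And>S T. S \<in> sets M \<Longrightarrow> T \<in> sets M \<Longrightarrow> S \<subseteq> T \<Longrightarrow> \<nu> S \<le> \<nu> T"
  shows "variation_norm M \<nu> \<le> ennreal (\<nu> (space M) - \<nu> {})"
  unfolding variation_norm_def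
proof (intro SUP_least ennreal_leI)
  fix C assume "C \<in> chains M"
  then obtain S m where S: "C = {(S i, S (Suc i)) |i. i < m}" "S 0 = {}" "S m = space M"
      "\<forall>i\<le>m. S i \<in> sets M" "\<forall>i<m. S i \<subseteq> S (Suc i)"
    unfolding chains_def by blast
  have C: "C = (\<lambda>i. (S i, S (Suc i))) ` {..<m}" using S(1) by auto
  \<comment> \<open>Different indices may give the same link, so the sum over the set of links is
    only bounded by the sum over indices, which telescopes.\<close>
  have "variation_on \<nu> C \<le> (\<Sum>i<m. \<bar>\<nu> (S (Suc i)) - \<nu> (S i)\<bar>)"
    unfolding variation_on_def C
    using sum_image_le[of "{..<m}" "\<lambda>(S, T). \<bar>\<nu> T - \<nu> S\<bar>" "\<lambda>i. (S i, S (Suc i))"]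
    by (auto simp: o_def)
  also have "\<dots> = (\<Sum>i<m. \<nu> (S (Suc i)) - \<nu> (S i))"
    using S assms by (intro sum.cong refl abs_of_nonneg) simp
  also have "\<dots> = \<nu> (space M) - \<nu> {}"
    using sum_lessThan_telescope[of "\<lambda>i. \<nu> (S i)" m] S by simp
  finally show "variation_on \<nu> C \<le> \<nu> (space M) - \<nu> {}" .
qed

text \<open>The trivial chain suffices. Its degenerate second link contributes nothing; for an empty
  space the two links coincide.\<close>

lemma variation_norm_ge:
  assumes "\<nu> {} = 0"
  shows "ennreal \<bar>\<nu> (space M)\<bar> \<le> variation_norm M \<nu>"
proof -
  have "ennreal (variation_on \<nu> {({}, space M), (space M, space M)}) \<le> variation_norm M \<nu>"
    unfolding variation_norm_def by (intro SUP_upper chains_two_links) auto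
  moreover have "\<bar>\<nu> (space M)\<bar> \<le> variation_on \<nu> {({}, space M), (space M, space M)}"
    using assms by (cases "space M = {}") (auto simp: variation_on_def)
  ultimately show ?thesis using ennreal_leI order_trans by blast
qed

text \<open>In contrapositive form it carries discontinuity from the power combinations to the
  larger space.\<close>

lemma variation_continuous_on_subset:
  "variation_continuous_on M Y T \<Longrightarrow> X \<subseteq> Y \<Longrightarrow> variation_continuous_on M X T"
  unfolding variation_continuous_on_def by (meson subsetD)

text \<open>The constant term cancels and the linear coefficient is \<open>n\<close>, so dividing by
  \<open>n\<close> gives a power combination with linear coefficient 1.\<close>

lemma one_minus_power_eq_sum:
  fixes x :: real
  shows "1 - (1 - x) ^ n = (\<Sum>k=1..n. - (of_nat (n choose k) * (-1) ^ k) * x ^ k)"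
proof -
  have "(1 - x) ^ n = (\<Sum>k\<le>n. of_nat (n choose k) * (- x) ^ k * 1 ^ (n - k))"
    using binomial_ring[of "- x" 1 n] by simp
  also have "\<dots> = (\<Sum>k\<le>n. of_nat (n choose k) * (-1) ^ k * x ^ k)"
    by (intro sum.cong refl) (simp add: power_minus[of x])
  also have "\<dots> = 1 + (\<Sum>k=1..n. of_nat (n choose k) * (-1) ^ k * x ^ k)"
    by (simp add: atMost_atLeast0 sum.atLeast_Suc_atMost)
  finally show ?thesis by (simp add: sum_negf)
qed

section \<open>Power combinations and their integrals\<close>

context borel_subspace
begin

lemma NA_pos_measure:
  assumes "\<mu> \<in> NA_pos M"
  shows "\<mu> {} = 0" "E \<notin> sets M \<Longrightarrow> \<mu> E = 0" "0 \<le> \<mu> E"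
    and "S \<in> sets M \<Longrightarrow> T \<in> sets M \<Longrightarrow> S \<subseteq> T \<Longrightarrow> \<mu> S \<le> \<mu> T"
proof -
  obtain N where N: "finite_measure N" "sets N = sets M" "\<mu> = measure N"
    using assms nonneg_signed_measure_imp_measure[of M \<mu>] unfolding NA_pos_iff by blast
  show "\<mu> {} = 0" "E \<notin> sets M \<Longrightarrow> \<mu> E = 0" "0 \<le> \<mu> E"
    and "S \<in> sets M \<Longrightarrow> T \<in> sets M \<Longrightarrow> S \<subseteq> T \<Longrightarrow> \<mu> S \<le> \<mu> T"
    using N finite_measure.finite_measure_mono[OF N(1), of S T] by (auto simp: measure_notin_sets)
qed

text \<open>For \<open>r = 1\<close> every sum equals \<open>\<mu> E\<close>. For larger
  \<open>r\<close> each term is at most \<open>\<delta> * \<mu> I\<close>, so the sums are at most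
  \<open>\<delta> * \<mu> E\<close>.\<close>

lemma has_BC_integral_at_power:
  assumes \<mu>: "\<mu> \<in> NA_pos M" and "1 \<le> r" and E: "E \<in> sets M"
  shows "has_BC_integral_at M \<mu> (\<lambda>I. \<mu> I ^ r) E (if r = 1 then \<mu> E else 0)"
proof (rule has_BC_integral_atI)
  fix \<epsilon> :: real assume "\<epsilon> > 0"
  note nn = NA_pos_measure(3)[OF \<mu>]
  have sum: "(\<Sum>I\<in>D. \<mu> I) = \<mu> E" if "D \<in> finite_partitions M E" for D
    using \<mu> that additive_signed_measure
    by (intro additive_sum_partition NA_pos_measure(1)) (auto simp: NA_pos_iff)
  \<comment> \<open>The bound 1 allows exponents above 2 to be lowered to 2; adding 1 to
    \<open>\<mu> E\<close> avoids a zero denominator and makes the final estimate strict.\<close>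
  define \<delta> where "\<delta> = min 1 (\<epsilon> / (\<mu> E + 1))"
  have \<delta>: "\<delta> > 0" "\<delta> \<le> 1" "\<delta> * (\<mu> E + 1) \<le> \<epsilon>"
    using \<open>\<epsilon> > 0\<close> nn[of E] by (auto simp: \<delta>_def pos_le_divide_eq[symmetric])
  have "\<bar>(\<Sum>I\<in>D. \<mu> I ^ r) - (if r = 1 then \<mu> E else 0)\<bar> < \<epsilon>"
    if D: "D \<in> finite_partitions M E" "\<forall>I\<in>D. \<mu> I < \<delta>" for D
  proof (cases "r = 1")
    case True
    then show ?thesis using sum[OF D(1)] \<open>\<epsilon> > 0\<close> by simp
  next
    case False
    with \<open>1 \<le> r\<close> have "2 \<le> r" by simp
    have "\<mu> I ^ r \<le> \<delta> * \<mu> I" if "I \<in> D" for I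
    proof -
      have "\<mu> I ^ r \<le> \<mu> I ^ 2"
        using nn[of I] D(2) that \<delta>(2) \<open>2 \<le> r\<close> by (intro power_decreasing) auto
      also have "\<dots> \<le> \<delta> * \<mu> I"
        using nn[of I] D(2) that by (auto simp: power2_eq_square intro!: mult_right_mono)
      finally show ?thesis .
    qed
    then have "(\<Sum>I\<in>D. \<mu> I ^ r) \<le> (\<Sum>I\<in>D. \<delta> * \<mu> I)" by (intro sum_mono)
    also have "\<dots> = \<delta> * \<mu> E" using sum[OF D(1)] by (simp flip: sum_distrib_left)
    also have "\<dots> < \<delta> * (\<mu> E + 1)" using \<delta>(1) by simp
    also note \<delta>(3)
    finally have "(\<Sum>I\<in>D. \<mu> I ^ r) < \<epsilon>" .
    moreover have "0 \<le> (\<Sum>I\<in>D. \<mu> I ^ r)" using nn by (intro sum_nonneg zero_le_power)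
    ultimately show ?thesis using False by simp
  qed
  with \<delta>(1) show "\<exists>\<delta>>0. \<forall>D\<in>finite_partitions M E. (\<forall>I\<in>D. \<mu> I < \<delta>) \<longrightarrow>
      \<bar>(\<Sum>I\<in>D. \<mu> I ^ r) - (if r = 1 then \<mu> E else 0)\<bar> < \<epsilon>" by blast
qed

text \<open>The sum of the measures dominates each of them and serves as common control.\<close>

lemma power_combination_has_BC_integral:
  assumes "finite J" "\<And>k. k \<in> J \<Longrightarrow> 1 \<le> r k \<and> \<mu> k \<in> NA_pos M" and "E \<in> sets M"
  shows "has_BC_integral_at M (\<lambda>I. \<Sum>k\<in>J. \<mu> k I) (\<lambda>I. \<Sum>k\<in>J. \<alpha> k * \<mu> k I ^ r k) E
    (\<Sum>k\<in>J. \<alpha> k * (if r k = 1 then \<mu> k E else 0))"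
proof (intro has_BC_integral_at_sum has_BC_integral_at_cmult)
  fix k assume k: "k \<in> J"
  show "has_BC_integral_at M (\<lambda>I. \<Sum>k\<in>J. \<mu> k I) (\<lambda>I. \<mu> k I ^ r k) E (if r k = 1 then \<mu> k E else 0)"
  proof (rule has_BC_integral_at_mono[OF has_BC_integral_at_power])
    show "\<mu> k I \<le> (\<Sum>k\<in>J. \<mu> k I)" for I
      using assms k NA_pos_measure(3) by (intro member_le_sum) auto
  qed (use assms k in auto)
qed (rule assms(1))

lemma BC_integral_power_combination:
  assumes "finite J" "\<And>k. k \<in> J \<Longrightarrow> 1 \<le> r k \<and> \<mu> k \<in> NA_pos M" and "E \<in> sets M"
  shows "BC_integral M (\<lambda>I. \<Sum>k\<in>J. \<alpha> k * \<mu> k I ^ r k) E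
    = (\<Sum>k\<in>J. \<alpha> k * (if r k = 1 then \<mu> k E else 0))"
proof (rule BC_integral_eqI)
  show "(\<lambda>E. \<Sum>k\<in>J. \<mu> k E) \<in> NA_pos M" using assms by (intro NA_pos_sum) auto
  show "BC_integrable M (\<lambda>E. \<Sum>k\<in>J. \<mu> k E) (\<lambda>I. \<Sum>k\<in>J. \<alpha> k * \<mu> k I ^ r k)"
    unfolding BC_integrable_def
    by (intro ballI exI) (rule power_combination_has_BC_integral[OF assms(1,2)])
qed (use power_combination_has_BC_integral[OF assms] assms(3) in auto)

text \<open>On the unit interval the power \<open>r\<close> is \<open>r\<close>-Lipschitz, and along
  an inclusion each \<open>\<mu> k\<close> grows by at most as much as the sum of all of them. The
  sum is thus a control for absolute continuity as well.\<close>

lemma power_combination_in_BC_AC4: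
  assumes "finite J" and J: "\<And>k. k \<in> J \<Longrightarrow> 1 \<le> r k \<and> \<mu> k \<in> nonatomic_prob M"
  shows "(\<lambda>I. \<Sum>k\<in>J. \<alpha> k * \<mu> k I ^ r k) \<in> BC_AC4 M"
proof -
  let ?\<nu> = "\<lambda>I. \<Sum>k\<in>J. \<alpha> k * \<mu> k I ^ r k" and ?\<kappa> = "\<lambda>I. \<Sum>k\<in>J. \<mu> k I"
  have \<mu>: "\<mu> k \<in> NA_pos M" "\<mu> k (space M) = 1" "1 \<le> r k" if "k \<in> J" for k
    using J[OF that] by (auto simp: nonatomic_prob_def)
  have \<kappa>: "?\<kappa> \<in> NA_pos M" using assms(1) \<mu>(1) by (rule NA_pos_sum)
  \<comment> \<open>Positive exponents matter here, since \<open>0 ^ 0 = 1\<close>.\<close>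
  have zero: "\<mu> k I ^ r k = 0" if "k \<in> J" "I = {} \<or> I \<notin> sets M" for k I
    using NA_pos_measure(1,2)[OF \<mu>(1)[OF that(1)]] \<mu>(3)[OF that(1)] that(2) by auto
  have "?\<nu> I = 0" if "I = {} \<or> I \<notin> sets M" for I
  proof (intro sum.neutral ballI)
    fix k assume "k \<in> J"
    then have "\<mu> k I ^ r k = 0" using that by (rule zero)
    then show "\<alpha> k * \<mu> k I ^ r k = 0" by (simp only: mult_zero_right)
  qed
  then have "game M ?\<nu>" by (simp add: game_def)
  moreover have "BC_integrable M ?\<kappa> ?\<nu>"
    unfolding BC_integrable_def
    by (intro ballI exI) (rule power_combination_has_BC_integral[OF assms(1)], use \<mu> in auto)
  moreover have "abs_cont4 M ?\<nu> ?\<kappa>"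
  proof (rule abs_cont4_if_Lipschitz)
    fix S T assume ST: "S \<in> sets M" "T \<in> sets M" "S \<subseteq> T"
    have mono: "0 \<le> \<mu> k S" "\<mu> k S \<le> \<mu> k T" "\<mu> k T \<le> 1" if "k \<in> J" for k
      using NA_pos_measure(3,4)[OF \<mu>(1)[OF that]] \<mu>(2)[OF that] ST
        sets.sets_into_space[OF ST(2)] sets.top[of M] by metis+
    have "\<bar>?\<nu> T - ?\<nu> S\<bar> \<le> (\<Sum>k\<in>J. \<bar>\<alpha> k * \<mu> k T ^ r k - \<alpha> k * \<mu> k S ^ r k\<bar>)"
      unfolding sum_subtractf[symmetric] by (rule sum_abs)
    also have "\<dots> \<le> (\<Sum>k\<in>J. (\<bar>\<alpha> k\<bar> * r k) * \<bar>?\<kappa> T - ?\<kappa> S\<bar>)"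
    proof (rule sum_mono)
      fix k assume k: "k \<in> J"
      have "\<mu> k T - \<mu> k S \<le> (\<Sum>k\<in>J. \<mu> k T - \<mu> k S)"
        using k mono assms(1) by (intro member_le_sum[of k J "\<lambda>k. \<mu> k T - \<mu> k S"]) auto
      then have "\<bar>\<mu> k T - \<mu> k S\<bar> \<le> \<bar>?\<kappa> T - ?\<kappa> S\<bar>"
        using mono[OF k] by (simp add: sum_subtractf)
      moreover have "\<bar>\<mu> k T ^ r k - \<mu> k S ^ r k\<bar> \<le> r k * \<bar>\<mu> k T - \<mu> k S\<bar>"
        using norm_power_diff[of "\<mu> k T" "\<mu> k S" "r k"] mono[OF k] by simp
      ultimately have "\<bar>\<mu> k T ^ r k - \<mu> k S ^ r k\<bar> \<le> r k * \<bar>?\<kappa> T - ?\<kappa> S\<bar>"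
        by (meson mult_left_mono of_nat_0_le_iff order_trans)
      then have "\<bar>\<alpha> k\<bar> * \<bar>\<mu> k T ^ r k - \<mu> k S ^ r k\<bar> \<le> \<bar>\<alpha> k\<bar> * (r k * \<bar>?\<kappa> T - ?\<kappa> S\<bar>)"
        by (rule mult_left_mono) simp
      then show "\<bar>\<alpha> k * \<mu> k T ^ r k - \<alpha> k * \<mu> k S ^ r k\<bar> \<le> (\<bar>\<alpha> k\<bar> * r k) * \<bar>?\<kappa> T - ?\<kappa> S\<bar>"
        by (simp add: mult.assoc flip: right_diff_distrib abs_mult)
    qed
    finally show "\<bar>?\<nu> T - ?\<nu> S\<bar> \<le> (\<Sum>k\<in>J. \<bar>\<alpha> k\<bar> * r k) * \<bar>?\<kappa> T - ?\<kappa> S\<bar>"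
      by (simp add: sum_distrib_right)
  qed (auto intro: sum_nonneg)
  ultimately show ?thesis using \<kappa> by (auto simp: BC_AC4_def BC_def AC4_def)
qed

lemma power_combinations_subset: "power_combinations M \<subseteq> BC_AC4 M"
  unfolding power_combinations_def using power_combination_in_BC_AC4 by blast

section \<open>Existence of a nonatomic probability and discontinuity\<close>

text \<open>The image of Lebesgue measure under the Borel injection: by injectivity the preimage of
  a point in the unit interval is finite, hence null.\<close>

lemma nonatomic_prob_nonempty:
  assumes "uncountable \<Omega>"
  shows "nonatomic_prob M \<noteq> {}"
proof -
  obtain h :: "real \<Rightarrow> 'a" where h: "h \<in> borel_measurable borel" "inj_on h {0..<1}" "h ` {0..<1} \<subseteq> \<Omega>"
    using uncountable_borel_injection[OF borel_\<Omega> assms] by blast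
  define L where "L = restrict_space lborel {0..<1::real}"
  have hL: "h \<in> L \<rightarrow>\<^sub>M M"
    unfolding L_def M_eq using h by (intro measurable_restrict_space3) auto
  define N where "N = distr L M h"
  have em: "emeasure N E = emeasure lborel (h -` E \<inter> {0..<1})" if "E \<in> sets M" for E
  proof -
    have "emeasure N E = emeasure L (h -` E \<inter> {0..<1})"
      using that hL by (simp add: N_def emeasure_distr L_def space_restrict_space)
    also have "\<dots> = emeasure lborel (h -` E \<inter> {0..<1})"
      unfolding L_def by (rule emeasure_restrict_space) auto
    finally show ?thesis .
  qed
  have top: "emeasure N (space M) = 1"
  proof -
    have "h -` \<Omega> \<inter> {0..<1} = {0..<1}" using h(3) by auto
    then show ?thesis using em[OF sets.top] by (simp add: space_M)
  qed
  have "space N = space M" "sets N = sets M" by (simp_all add: N_def)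
  then have N: "finite_measure N" "sets N = sets M" using top by (auto intro!: finite_measureI)
  have "measure N {x} = 0" for x
  proof (cases "{x} \<in> sets M")
    case True
    have "finite (h -` {x} \<inter> {0..<1})" using h(2) by (rule finite_vimage_IntI[rotated]) simp
    then have "emeasure N {x} = 0"
      using em[OF True] by (simp add: emeasure_lborel_countable countable_finite)
    then show ?thesis by (simp add: measure_def)
  qed (simp add: measure_notin_sets N(2))
  then have "measure N \<in> NA_pos M" using signed_measure_measure[OF N] by (simp add: NA_pos_iff)
  moreover have "measure N (space M) = 1" using top by (simp add: measure_def)
  ultimately show ?thesis by (auto simp: nonatomic_prob_def)
qed

theorem not_continuous_on_power_combinations:
  assumes "uncountable \<Omega>"
  shows "\<not> variation_continuous_on M (power_combinations M) (BC_integral M)"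
proof
  assume cont: "variation_continuous_on M (power_combinations M) (BC_integral M)"
  obtain \<mu> where "\<mu> \<in> nonatomic_prob M" using nonatomic_prob_nonempty[OF assms] by blast
  then have \<mu>: "\<mu> \<in> nonatomic_prob M" "\<mu> \<in> NA_pos M" "\<mu> (space M) = 1"
    by (auto simp: nonatomic_prob_def)
  note \<mu>_simps = NA_pos_measure[OF \<mu>(2)]
  define P where "P n \<alpha> = (\<lambda>E. \<Sum>k=1..n. \<alpha> k * \<mu> E ^ k)" for n and \<alpha> :: "nat \<Rightarrow> real"
  have P: "P n \<alpha> \<in> power_combinations M" if "1 \<le> n" for n \<alpha>
    unfolding power_combinations_def P_def mem_Collect_eq using that \<mu>(1)
    by (intro exI[of _ n] exI[of _ \<alpha>] exI[of _ "\<lambda>k. k"] exI[of _ "\<lambda>k. \<mu>"]) auto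
  have integral: "BC_integral M (P n \<alpha>) E = \<alpha> 1 * \<mu> E" if "1 \<le> n" "E \<in> sets M" for n \<alpha> E
  proof -
    have "BC_integral M (P n \<alpha>) E = (\<Sum>k=1..n. \<alpha> k * (if k = 1 then \<mu> E else 0))"
      unfolding P_def using \<mu>(2) that(2)
      by (intro BC_integral_power_combination[where r = "\<lambda>k. k" and \<mu> = "\<lambda>k. \<mu>"]) auto
    also have "\<dots> = (\<Sum>k\<in>{1}. \<alpha> k * (if k = 1 then \<mu> E else 0))"
      using that(1) by (intro sum.mono_neutral_right) auto
    finally show ?thesis by simp
  qed
  \<comment> \<open>The zero game is written with one vanishing coefficient because combinations
    have at least one term. Continuity is refuted at this game, with tolerance 1.\<close>
  have zero: "P 1 (\<lambda>_. 0) = (\<lambda>E. 0)" by (simp add: P_def)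
  have "P 1 (\<lambda>_. 0) \<in> power_combinations M" "(0::real) < 1" using P by simp_all
  with cont obtain \<delta> :: real where \<delta>: "\<delta> > 0"
    "\<And>\<nu>. \<nu> \<in> power_combinations M \<Longrightarrow> variation_norm M (\<lambda>E. \<nu> E - P 1 (\<lambda>_. 0) E) < ennreal \<delta> \<Longrightarrow>
      variation_norm M (\<lambda>E. BC_integral M \<nu> E - BC_integral M (P 1 (\<lambda>_. 0)) E) < ennreal 1"
    unfolding variation_continuous_on_def by blast
  obtain m where m: "inverse (real (Suc m)) < \<delta>" using reals_Archimedean[OF \<delta>(1)] by blast
  define n where "n = Suc m"
  \<comment> \<open>These are the binomial coefficients of \<open>(1 - (1 - x) ^ n) / n\<close>. The
    linear one is 1, so the integral is \<mu> for every \<open>n\<close>.\<close>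
  define \<alpha> where "\<alpha> k = - (of_nat (n choose k) * (-1) ^ k) / real n" for k
  have n: "1 \<le> n" "1 / real n < \<delta>" using m by (auto simp: n_def inverse_eq_divide)
  have P_eq: "P n \<alpha> E = (1 - (1 - \<mu> E) ^ n) / real n" for E
    unfolding P_def \<alpha>_def one_minus_power_eq_sum by (simp add: sum_divide_distrib)
  have "variation_norm M (P n \<alpha>) \<le> ennreal (P n \<alpha> (space M) - P n \<alpha> {})"
  proof (rule variation_norm_mono_le)
    fix S T assume ST: "S \<in> sets M" "T \<in> sets M" "S \<subseteq> T"
    have "\<mu> S \<le> \<mu> T" "\<mu> T \<le> 1"
      using \<mu>_simps(4) ST \<mu>(3) sets.sets_into_space[OF ST(2)] sets.top[of M] by metis+
    then have "(1 - \<mu> T) ^ n \<le> (1 - \<mu> S) ^ n" by (intro power_mono) auto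
    then show "P n \<alpha> S \<le> P n \<alpha> T" by (simp add: P_eq divide_right_mono)
  qed
  also have "P n \<alpha> (space M) - P n \<alpha> {} = 1 / real n"
    using n(1) by (simp add: P_eq \<mu>(3) \<mu>_simps(1) power_0_left)
  also have "ennreal (1 / real n) < ennreal \<delta>" using n(2) \<delta>(1) by (simp add: ennreal_less_iff)
  finally have "variation_norm M (\<lambda>E. BC_integral M (P n \<alpha>) E - BC_integral M (P 1 (\<lambda>_. 0)) E) < ennreal 1"
    using P[OF n(1)] by (intro \<delta>(2)) (simp_all only: zero diff_0_right)
  moreover have "\<alpha> 1 = 1" using n(1) by (simp add: \<alpha>_def)
  \<comment> \<open>On the whole space the integral of \<open>P n \<alpha>\<close> is 1 and that of
    the zero game is 0, which bounds the norm of the difference from below.\<close>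
  then have "ennreal 1 \<le> variation_norm M (\<lambda>E. BC_integral M (P n \<alpha>) E - BC_integral M (P 1 (\<lambda>_. 0)) E)"
    using variation_norm_ge[of "\<lambda>E. BC_integral M (P n \<alpha>) E - BC_integral M (P 1 (\<lambda>_. 0)) E" M]
      integral n(1) \<mu>(3) \<mu>_simps(1) by simp
  ultimately show False by simp
qed

end

theorem mainTheorem3:
  fixes \<Omega> :: "'a :: polish_space set" and M :: "'a measure"
  assumes "\<Omega> \<in> sets borel"
    and "uncountable \<Omega>"
    and "M = restrict_space borel \<Omega>"
  shows "power_combinations M \<subseteq> BC_AC4 M \<and>
    BC_integral M ` BC_AC4 M \<subseteq> NA M \<and>
    \<not> variation_continuous_on M (power_combinations M) (BC_integral M) \<and>
    \<not> variation_continuous_on M (BC_AC4 M) (BC_integral M)"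
proof -
  interpret borel_subspace \<Omega> M using assms(1,3) by unfold_locales
  show ?thesis
    using power_combinations_subset BC_integral_in_NA
      not_continuous_on_power_combinations[OF assms(2)] variation_continuous_on_subset by blast
qed

end
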